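(* Let $n\ge 3$ be odd. Then $\{\mathcal{F}_C : C \text{ is a self-dual code in } \mathbb{F}_2^{n+1}\}$ is a partition of $\mathcal{SD}_n$; i.e. each $\mathcal{F}_C\subseteq\mathcal{SD}_n$, $\mathcal{F}_C\cap\mathcal{F}_{\widetilde C}=\emptyset$ for distinct self-dual codes $C\neq\widetilde C$, and every element of $\mathcal{SD}_n$ lies in some $\mathcal{F}_C$.
   Context: $\mathbb{F}_2$ is the binary field; $\mathrm{SGL}_n(\mathbb{F}_2)$ is the set of invertible symmetric $n\times n$ matrices over $\mathbb{F}_2$; $\Gamma_n$ is the graph on $\mathrm{SGL}_n(\mathbb{F}_2)$ with $A\sim B$ iff $\mathrm{rank}(A-B)=1$, $d$ its graph distance. $\mathcal{SD}_n=\{A\in\mathrm{SGL}_n(\mathbb{F}_2): d(A,I_n)=\frac{n+5}{2},\ \mathrm{rank}(A-I_n)=\frac{n+1}{2}\}$. A code $C\subseteq\mathbb{F}_2^{n+1}$ is self-dual if $C=C^\perp$ (standard dot product); then $\dim C=m:=\frac{n+1}{2}$. For $\mathbf{y}\in\mathbb{F}_2^{n+1}$, $\underline{\mathbf{y}}\in\mathbb{F}_2^n$ is $\mathbf{y}$ with its last entry deleted; $\mathbf{x}^2:=\mathbf{x}\mathbf{x}^{\top}$. Let $\mathfrak{B}_C$ be the set of bases of $C$, $\mathfrak{B}_C^2$ those bases containing an even number of vectors with last entry $1$. For $\mathcal{B}=\{\mathbf{y}_1,\ldots,\mathbf{y}_m\}\in\mathfrak{B}_C$ put $A'_{\mathcal{B}}=I_n+\sum_{i=1}^m\underline{\mathbf{y}_i}^2$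 and $A''_{\mathcal{B}}=I_n+\sum_{i=1}^m\underline{\mathbf{y}_i}^2+(\underline{\mathbf{y}_1}+\cdots+\underline{\mathbf{y}_m})^2$. Define $\mathcal{F}_C=\{A'_{\mathcal{B}}:\mathcal{B}\in\mathfrak{B}_C^2\}\cup\{A''_{\mathcal{B}}:\mathcal{B}\in\mathfrak{B}_C\}$ if $m$ is even, and $\mathcal{F}_C=\{A'_{\mathcal{B}}:\mathcal{B}\in\mathfrak{B}_C^2\}$ if $m$ is odd. *)

theory Defs
  imports "Jordan_Normal_Form.DL_Rank" "HOL-Library.Z2" "HOL-Library.Extended_Nat"
begin

definition rk :: "nat \<Rightarrow> bit mat \<Rightarrow> nat" where
  "rk n A = vec_space.rank n A"

definition SGL :: "nat \<Rightarrow> bit mat set" where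
  "SGL n = {A. A \<in> carrier_mat n n \<and> transpose_mat A = A \<and> invertible_mat A}"

definition Gamma_edge :: "nat \<Rightarrow> (bit mat \<times> bit mat) set" where
  "Gamma_edge n = {(A, B). A \<in> SGL n \<and> B \<in> SGL n \<and> rk n (A - B) = 1}"

text \<open>Graph distance (infinity if not connected).\<close>
definition gdist :: "nat \<Rightarrow> bit mat \<Rightarrow> bit mat \<Rightarrow> enat" where
  "gdist n A B = Inf {enat k | k. (A, B) \<in> (Gamma_edge n) ^^ k}"

definition SD :: "nat \<Rightarrow> bit mat set" where
  "SD n = {A \<in> SGL n. gdist n A (1\<^sub>m n) = enat ((n + 5) div 2)
                      \<and> rk n (A - 1\<^sub>m n) = (n + 1) div 2}"

definition dual_code :: "nat \<Rightarrow> bit vec set \<Rightarrow> bit vec set" where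
  "dual_code k C = {x \<in> carrier_vec k. \<forall>y \<in> C. x \<bullet> y = 0}"

definition self_dual :: "nat \<Rightarrow> bit vec set \<Rightarrow> bool" where
  "self_dual k C \<longleftrightarrow> C \<subseteq> carrier_vec k \<and> C = dual_code k C"

definition is_basis :: "nat \<Rightarrow> bit vec set \<Rightarrow> bit vec set \<Rightarrow> bool" where
  "is_basis k C B \<longleftrightarrow> B \<subseteq> C \<and> finite B
     \<and> LinearCombinations.module.lin_indpt class_ring (module_vec TYPE(bit) k) B
     \<and> LinearCombinations.module.span class_ring (module_vec TYPE(bit) k) B = C"

definition bases :: "nat \<Rightarrow> bit vec set \<Rightarrow> bit vec set set" where
  "bases k C = {B. is_basis k C B}"

definition bases2 :: "nat \<Rightarrow> bit vec set \<Rightarrow> bit vec set set" where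
  "bases2 n C = {B \<in> bases (n + 1) C. even (card {y \<in> B. y $ n = 1})}"

definition under :: "nat \<Rightarrow> bit vec \<Rightarrow> bit vec" where
  "under n y = vec n (\<lambda>i. y $ i)"

definition sq :: "bit vec \<Rightarrow> bit mat" where
  "sq x = mat (dim_vec x) (dim_vec x) (\<lambda>(i, j). x $ i * x $ j)"

definition mat_sum :: "nat \<Rightarrow> (bit vec \<Rightarrow> bit mat) \<Rightarrow> bit vec set \<Rightarrow> bit mat" where
  "mat_sum n f B = mat n n (\<lambda>(i, j). \<Sum>y \<in> B. f y $$ (i, j))"

definition vec_sum :: "nat \<Rightarrow> (bit vec \<Rightarrow> bit vec) \<Rightarrow> bit vec set \<Rightarrow> bit vec" where
  "vec_sum n f B = vec n (\<lambda>i. \<Sum>y \<in> B. f y $ i)"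

definition A1 :: "nat \<Rightarrow> bit vec set \<Rightarrow> bit mat" where
  "A1 n B = 1\<^sub>m n + mat_sum n (\<lambda>y. sq (under n y)) B"

definition A2 :: "nat \<Rightarrow> bit vec set \<Rightarrow> bit mat" where
  "A2 n B = 1\<^sub>m n + mat_sum n (\<lambda>y. sq (under n y)) B + sq (vec_sum n (under n) B)"

definition FC :: "nat \<Rightarrow> bit vec set \<Rightarrow> bit mat set" where
  "FC n C = (if even ((n + 1) div 2)
             then {A1 n B | B. B \<in> bases2 n C} \<union> {A2 n B | B. B \<in> bases (n + 1) C}
             else {A1 n B | B. B \<in> bases2 n C})"

end

theory Submission
  imports Defs "HOL-Library.Function_Algebras"
begin

text \<open>
Put D = A + I and let E + I be the inverse of A. Both D and E have the same column space V, and a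
path of length k from I to A writes D as a sum of k squares x x' such that I plus any partial sum is
invertible. Over the binary field x' D x is linear in x, being the product of x
with the diagonal of D; hence adding the square of D z keeps invertibility and lowers the rank
exactly when z has product 1 with the diagonals of both D and E.

Whether this descent can be continued down to rank 0 is governed by the alternating form
u.v + (u.u)(v.v) on V. If it vanishes while u.u does not, then V is the truncation of a
self-orthogonal code, every sequence of squares inside V with invertible partial sums consists of
vectors of even weight, and a shortest path has to leave V once, which costs two additional steps.
If it does not vanish, at most one additional step is needed. Counting shows that for rank
(n + 1) / 2 the first case means that V is the truncation of a self-dual code C, and diagonalising
D identifies the matrices with column space V as the class of C.
\<close>

text \<open>Carrying \<open>E\<close> along makes the descent symmetric: by the Sherman-Morrison
  formula, adding the square of \<open>D z\<close> to \<open>D\<close> adds the square of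
  \<open>E z\<close> to \<open>E\<close>, so one \<open>z\<close> controls both diagonals, called d
  and e here. A step can spoil the next one by killing d or e or by reaching a special space. All
  three are conditions on \<open>D z\<close>, that is, on the functional that \<open>z\<close>
  induces on V: d dies if D z = d, and by the identity D 1 = d + e + D e, e dies if D z = d + D 1. A
  nonzero alternating form vanishing on two hyperplanes is the wedge of their functionals, so at
  most two values are lost to special hyperplanes. At rank 2 a vanishing diagonal already forces V
  to be special.

  A self-dual code has a word ending in 1, so its truncation V contains a vector of odd weight and D
  1 is nonzero. If at most rank + 1 squares sum to \<open>D\<close>, they all come from V, and even
  weights would give D 1 = 0; hence (n + 5) / 2, which is the rank (n + 1) / 2 plus two.\<close>

declare add_bit_eq_xor [simp del] mult_bit_eq_and [simp del]

text \<open>Total functions put vectors of all lengths into one type with an unrestricted addition;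
  the set \<open>F\<close> below picks out those supported on the first \<open>n\<close>
  coordinates.\<close>

type_synonym bvec = "nat \<Rightarrow> bit"

lemma bit_double [simp]: "(a::bit) + a = 0" "(a::bit) + (a + b) = b"
  by (cases a; cases b; simp)+

lemma bit_sum_eq_iff: "(a::bit) + b = 0 \<longleftrightarrow> a = b" "(a::bit) + b = 1 \<longleftrightarrow> a \<noteq> b"
  by (cases a; cases b; simp)+

lemma bvec_double [simp]: "(x::bvec) + x = 0" "(x::bvec) + (x + y) = y"
  by (simp_all add: fun_eq_iff)

lemma bvec_zero_fold [simp]: "(\<lambda>_. 0) = (0::bvec)"
  by (simp add: fun_eq_iff)

lemma bvec_two [simp]: "(2::bvec) = 0"
  by (simp flip: one_add_one)

lemma bvec_eq_iff: "(x::bvec) = y \<longleftrightarrow> x + y = 0"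
proof
  assume "x + y = 0"
  then have "x + (x + y) = x" by simp
  then show "x = y" by simp
qed simp

definition scl :: "bit \<Rightarrow> bvec \<Rightarrow> bvec" where
  "scl c x = (if c = 1 then x else 0)"

lemma scl_simps [simp]: "scl 0 x = 0" "scl 1 x = x" "scl c 0 = 0"
  by (simp_all add: scl_def)

lemma scl_add: "scl c (x + y) = scl c x + scl c y"
  "scl (c + d) x = scl c x + scl d x"
  by (cases c; simp) (cases c; cases d; simp)

lemma scl_apply: "scl c x i = c * x i"
  by (cases c) simp_all

section \<open>Binary vectors and orthogonality\<close>

locale binary_space =
  fixes n :: nat
begin

definition dot :: "bvec \<Rightarrow> bvec \<Rightarrow> bit" where
  "dot x y = (\<Sum>i<n. x i * y i)"

definition F :: "bvec set" where
  "F = {x. \<forall>i\<ge>n. x i = 0}"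

definition ones :: bvec where
  "ones = (\<lambda>i. if i < n then 1 else 0)"

definition unit :: "nat \<Rightarrow> bvec" where
  "unit i = (\<lambda>j. if j = i then 1 else 0)"

lemma dot_add [simp]: "dot x (y + z) = dot x y + dot x z" "dot (x + y) z = dot x z + dot y z"
  by (simp_all add: dot_def algebra_simps sum.distrib)

lemma dot_zero [simp]: "dot 0 x = 0" "dot x 0 = 0"
  by (simp_all add: dot_def)

lemma dot_scl [simp]: "dot x (scl c y) = c * dot x y" "dot (scl c x) y = c * dot x y"
  by (cases c; simp)+

lemma dot_commute: "dot x y = dot y x"
  by (simp add: dot_def mult.commute)

text \<open>Squaring is the identity on the field, so the parity of the weight is at once a linear
  functional and the form x.x.\<close>

lemma dot_ones: "dot ones x = dot x x"
proof -
  have "ones i * x i = x i * x i" if "i < n" for i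
    using that by (cases "x i") (simp_all add: ones_def)
  then show ?thesis unfolding dot_def by (intro sum.cong) auto
qed

lemma F_add [simp, intro]: "x \<in> F \<Longrightarrow> y \<in> F \<Longrightarrow> x + y \<in> F"
  and F_zero [simp]: "0 \<in> F"
  and F_ones [simp]: "ones \<in> F"
  and F_unit: "i < n \<Longrightarrow> unit i \<in> F"
  by (auto simp: F_def ones_def unit_def)

lemma F_scl [simp, intro]: "x \<in> F \<Longrightarrow> scl c x \<in> F"
  by (cases c) auto

lemma dot_unit: "i < n \<Longrightarrow> dot (unit i) x = x i"
proof -
  assume "i < n"
  have "(if j = i then 1 else 0) * x j = (if j = i then x j else 0)" for j by simp
  then show ?thesis using \<open>i < n\<close> by (simp add: dot_def unit_def)
qed

lemma nondegenerate:
  assumes "v \<in> F" "\<And>x. x \<in> F \<Longrightarrow> dot x v = 0"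
  shows "v = 0"
proof
  fix i show "v i = 0 i"
  proof (cases "i < n")
    case True
    then show ?thesis using assms(2)[OF F_unit[OF True]] dot_unit[OF True, of v] by simp
  next
    case False
    then show ?thesis using assms(1) by (simp add: F_def)
  qed
qed

lemma F_eqI:
  assumes "u \<in> F" "v \<in> F" "\<And>x. x \<in> F \<Longrightarrow> dot x u = dot x v"
  shows "u = v"
  using nondegenerate[of "u + v"] assms by (simp add: bvec_eq_iff[of u v])

lemma F_eq_image: "F = (\<lambda>S i. if i \<in> S then 1 else 0) ` Pow {..<n}"
proof
  show "F \<subseteq> (\<lambda>S i. if i \<in> S then 1 else 0) ` Pow {..<n}"
  proof
    fix x assume x: "x \<in> F"
    have "x i = 0" if "x i \<noteq> 1" for i using that by simp
    then have "x = (\<lambda>i. if i \<in> {i. i < n \<and> x i = 1} then 1 else 0)"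
      using x by (auto simp: F_def fun_eq_iff not_less)
    then show "x \<in> (\<lambda>S i. if i \<in> S then 1 else 0) ` Pow {..<n}"
      by (rule image_eqI) auto
  qed
qed (auto simp: F_def)

lemma finite_F [simp]: "finite F"
  by (simp add: F_eq_image)

lemma card_F: "card F = 2 ^ n"
proof -
  have "inj_on (\<lambda>S (i::nat). if i \<in> S then 1 else (0::bit)) (Pow {..<n})"
    by (rule inj_onI) (auto simp: fun_eq_iff split: if_splits)
  then show ?thesis unfolding F_eq_image by (simp add: card_image card_Pow)
qed

text \<open>Closure under addition suffices over two scalars. Cardinalities, as powers of two, play
  the role of dimensions.\<close>

definition subspace :: "bvec set \<Rightarrow> bool" where
  "subspace V \<longleftrightarrow> V \<subseteq> F \<and> 0 \<in> V \<and> (\<forall>x\<in>V. \<forall>y\<in>V. x + y \<in> V)"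

definition perp :: "bvec set \<Rightarrow> bvec set" where
  "perp V = {x \<in> F. \<forall>v\<in>V. dot x v = 0}"

lemma subspaceD:
  assumes "subspace V"
  shows "V \<subseteq> F" "0 \<in> V" "x \<in> V \<Longrightarrow> y \<in> V \<Longrightarrow> x + y \<in> V" "finite V"
  using assms finite_subset[OF _ finite_F] by (auto simp: subspace_def)

lemma subspace_scl: "subspace V \<Longrightarrow> x \<in> V \<Longrightarrow> scl c x \<in> V"
  by (cases c) (auto dest: subspaceD)

lemma subspace_F: "subspace F"
  by (auto simp: subspace_def)

lemma subspace_perp: "subspace (perp V)"
  by (auto simp: subspace_def perp_def)

lemma subspace_inter_perp: "subspace V \<Longrightarrow> subspace {v \<in> V. dot z v = 0}"
  by (auto simp: subspace_def)

lemma card_fibre: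
  assumes V: "subspace V" and u: "u \<in> V" "dot z u = 1"
  shows "card {v \<in> V. dot z v = 1} = card {v \<in> V. dot z v = 0}"
  by (rule bij_betw_same_card[of "\<lambda>v. u + v"], rule bij_betw_byWitness[where f' = "\<lambda>v. u + v"])
    (use u subspaceD[OF V] in auto)

lemma card_split:
  assumes "finite V"
  shows "card V = card {v \<in> V. dot z v = 0} + card {v \<in> V. dot z v = 1}"
proof -
  have "V = {v \<in> V. dot z v = 0} \<union> {v \<in> V. dot z v = 1}" by auto
  moreover have "card ({v \<in> V. dot z v = 0} \<union> {v \<in> V. dot z v = 1})
      = card {v \<in> V. dot z v = 0} + card {v \<in> V. dot z v = 1}"
    by (rule card_Un_disjoint) (use assms in auto)
  ultimately show ?thesis by simp
qed

lemma card_hyperplane: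
  assumes V: "subspace V" and u: "u \<in> V" "dot z u = 1"
  shows "card V = 2 * card {v \<in> V. dot z v = 0}"
  using card_split[of V z] card_fibre[OF assms] subspaceD[OF V] by simp

text \<open>Translation by \<open>u\<close> carries the common kernel of the two functionals, of
  codimension at most two in \<open>V\<close>, onto the set where both take the value 1. The
  inequality also covers functionals that agree on \<open>V\<close>.\<close>

lemma card_codim_two:
  assumes V: "subspace V" and u: "u \<in> V" "dot p u = 1" "dot q u = 1"
  shows "card V \<le> 4 * card {v \<in> V. dot p v = 1 \<and> dot q v = 1}"
proof -
  let ?V0 = "{v \<in> V. dot p v = 0}"
  have fin: "finite ?V0" using subspaceD[OF V] by simp
  have "card ?V0 \<le> 2 * card {v \<in> ?V0. dot q v = 0}"
  proof (cases "\<exists>w\<in>?V0. dot q w = 1")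
    case True
    then show ?thesis using card_hyperplane[OF subspace_inter_perp[OF V]] by force
  next
    case False
    then have "{v \<in> ?V0. dot q v = 0} = ?V0" by auto
    then show ?thesis by simp
  qed
  moreover have "card {v \<in> ?V0. dot q v = 0} = card {v \<in> V. dot p v = 1 \<and> dot q v = 1}"
    by (rule bij_betw_same_card[of "\<lambda>v. u + v"], rule bij_betw_byWitness[where f' = "\<lambda>v. u + v"])
      (use u subspaceD[OF V] in auto)
  ultimately show ?thesis using card_hyperplane[OF V u(1,2)] by linarith
qed

definition chi :: "bit \<Rightarrow> int" where
  "chi b = (if b = 0 then 1 else - 1)"

text \<open>Orthogonality of characters: a functional that is not identically 0 on \<open>V\<close>
  takes both values equally often, so the signs cancel.\<close>

lemma sum_chi:
  assumes V: "subspace V"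
  shows "(\<Sum>v\<in>V. chi (dot x v)) = (if \<forall>v\<in>V. dot x v = 0 then int (card V) else 0)"
proof (cases "\<forall>v\<in>V. dot x v = 0")
  case True
  then show ?thesis by (simp add: chi_def)
next
  case False
  then obtain u where u: "u \<in> V" "dot x u = 1" by auto
  have "V = {v \<in> V. dot x v = 0} \<union> {v \<in> V. dot x v = 1}" by auto
  moreover have "(\<Sum>v\<in>{v \<in> V. dot x v = 0} \<union> {v \<in> V. dot x v = 1}. chi (dot x v))
      = (\<Sum>v\<in>{v \<in> V. dot x v = 0}. chi (dot x v)) + (\<Sum>v\<in>{v \<in> V. dot x v = 1}. chi (dot x v))"
    by (rule sum.union_disjoint) (use subspaceD[OF V] in auto)
  ultimately have "(\<Sum>v\<in>V. chi (dot x v)) = 0"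
    using card_fibre[OF V u] by (simp add: chi_def)
  then show ?thesis using False by auto
qed

text \<open>Evaluate the sum of the characters of x.v over all x in F and v in V in both orders.\<close>
lemma card_perp:
  assumes V: "subspace V"
  shows "card V * card (perp V) = 2 ^ n"
proof -
  have "(\<Sum>x\<in>F. \<Sum>v\<in>V. chi (dot x v)) = (\<Sum>x\<in>F. if x \<in> perp V then int (card V) else 0)"
    by (rule sum.cong) (auto simp: sum_chi[OF V] perp_def)
  also have "\<dots> = (\<Sum>x\<in>perp V. int (card V))"
    by (rule sum.mono_neutral_cong_right) (auto simp: perp_def)
  finally have *: "(\<Sum>x\<in>F. \<Sum>v\<in>V. chi (dot x v)) = int (card V * card (perp V))" by simp
  have "(\<Sum>x\<in>F. chi (dot x v)) = (if v = 0 then int (card F) else 0)" if "v \<in> V" for v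
    using sum_chi[OF subspace_F, of v] nondegenerate[of v] that subspaceD[OF V]
    by (auto simp: dot_commute)
  then have "(\<Sum>v\<in>V. \<Sum>x\<in>F. chi (dot x v)) = (\<Sum>v\<in>V. if v = 0 then int (card F) else 0)"
    by (intro sum.cong) auto
  also have "\<dots> = int (card F)" using subspaceD[OF V] by simp
  finally have "int (card V * card (perp V)) = int (2 ^ n)"
    using * sum.swap[of "\<lambda>x v. chi (dot x v)" V F] card_F by simp
  then show ?thesis by (simp only: of_nat_eq_iff)
qed

lemma perp_perp:
  assumes V: "subspace V"
  shows "perp (perp V) = V"
proof -
  have "V \<subseteq> perp (perp V)" using subspaceD[OF V] by (auto simp: perp_def dot_commute)
  moreover have "card V = card (perp (perp V))"
  proof -
    have "card (perp V) * card V = card (perp V) * card (perp (perp V))"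
      using card_perp[OF V] card_perp[OF subspace_perp[of V]] by (simp add: mult.commute)
    moreover have "card (perp V) \<noteq> 0"
      using subspaceD[OF subspace_perp[of V]] by auto
    ultimately show ?thesis by simp
  qed
  moreover have "finite (perp (perp V))" using subspaceD[OF subspace_perp[of "perp V"]] by simp
  ultimately show ?thesis using card_subset_eq by metis
qed

end

declare plus_fun_apply [simp del] zero_fun_apply [simp del]


context binary_space
begin

section \<open>Symmetric operators and rank-one updates\<close>

text \<open>A symmetric n by n matrix acting on all of \<open>bvec\<close>: the range condition
  fixes the output beyond coordinate \<open>n\<close>, and self-adjointness makes the action blind
  to input coordinates there.\<close>

definition symop :: "(bvec \<Rightarrow> bvec) \<Rightarrow> bool" where
  "symop D \<longleftrightarrow> (\<forall>x y. D (x + y) = D x + D y) \<and> range D \<subseteq> F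
     \<and> (\<forall>x y. dot x (D y) = dot (D x) y)"

lemma symop_add: "symop D \<Longrightarrow> D (x + y) = D x + D y"
  and symop_F: "symop D \<Longrightarrow> D x \<in> F"
  and symop_adj: "symop D \<Longrightarrow> dot x (D y) = dot (D x) y"
  by (auto simp: symop_def)

lemma symop_zero: "symop D \<Longrightarrow> D 0 = 0"
  using symop_add[of D 0 0] by simp

lemma symop_scl: "symop D \<Longrightarrow> D (scl c x) = scl c (D x)"
  using symop_zero[of D] by (cases c) simp_all

lemma symop_range: "symop D \<Longrightarrow> subspace (range D)"
  unfolding subspace_def using symop_zero[of D] symop_F[of D] symop_add[of D]
  by (metis (no_types, lifting) image_subset_iff rangeE rangeI)

text \<open>Self-adjointness and nondegeneracy. The vector \<open>D x\<close> thus encodes the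
  functional that \<open>x\<close> induces on the column space, and later counts of functionals are
  counts of values \<open>D x\<close>.\<close>

lemma symop_eq_iff:
  assumes "symop D"
  shows "D x = D y \<longleftrightarrow> (\<forall>v\<in>range D. dot x v = dot y v)"
proof
  assume *: "\<forall>v\<in>range D. dot x v = dot y v"
  show "D x = D y"
  proof (rule F_eqI)
    fix u
    show "dot u (D x) = dot u (D y)"
      using * by (simp add: symop_adj[OF assms, of u] dot_commute[of "D u"])
  qed (simp_all add: symop_F[OF assms])
next
  assume *: "D x = D y"
  show "\<forall>v\<in>range D. dot x v = dot y v"
    using symop_adj[OF assms, of x] symop_adj[OF assms, of y] * by auto
qed

lemma perp_range:
  assumes "symop D"
  shows "perp (range D) = {k \<in> F. D k = 0}"
  using symop_eq_iff[OF assms, of _ 0] by (auto simp: perp_def symop_zero[OF assms])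

lemma symop_range_eq:
  assumes "symop D"
  shows "range D = perp {k \<in> F. D k = 0}"
  using perp_perp[OF symop_range[OF assms]] perp_range[OF assms] by simp

text \<open>Induction over prefixes of \<open>x\<close> assembles the representing vector coordinate
  by coordinate. Locality excludes functionals that read coordinates from \<open>n\<close> on, which
  \<open>dot\<close> cannot express.\<close>

lemma additive_functional:
  fixes f :: "bvec \<Rightarrow> bit"
  assumes add: "\<And>x y. f (x + y) = f x + f y"
    and local: "\<And>x y. (\<And>i. i < n \<Longrightarrow> x i = y i) \<Longrightarrow> f x = f y"
  shows "f x = dot (\<lambda>i. if i < n then f (unit i) else 0) x"
proof -
  have f0: "f 0 = 0" using add[of 0 0] by simp
  have "f (\<lambda>i. if i < k then x i else 0) = (\<Sum>i<k. f (unit i) * x i)" for k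
  proof (induction k)
    case 0
    then show ?case using f0 by simp
  next
    case (Suc k)
    have "(\<lambda>i. if i < Suc k then x i else 0) = (\<lambda>i. if i < k then x i else 0) + scl (x k) (unit k)"
      by (auto simp: fun_eq_iff scl_apply unit_def less_Suc_eq plus_fun_apply)
    moreover have "f (scl (x k) (unit k)) = f (unit k) * x k"
      by (cases "x k") (simp_all add: f0)
    ultimately show ?case using Suc by (simp add: add)
  qed
  from this[of n] have "f (\<lambda>i. if i < n then x i else 0) = dot (\<lambda>i. if i < n then f (unit i) else 0) x"
    by (simp add: dot_def)
  then show ?thesis using local[of "\<lambda>i. if i < n then x i else 0" x] by simp
qed

definition dg :: "(bvec \<Rightarrow> bvec) \<Rightarrow> bvec" where
  "dg D = (\<lambda>i. if i < n then D (unit i) i else 0)"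

lemma dg_F [simp]: "dg D \<in> F"
  by (simp add: dg_def F_def)

lemma dot_local: "(\<And>i. i < n \<Longrightarrow> x i = y i) \<Longrightarrow> dot x v = dot y v"
  by (simp add: dot_def)

text \<open>By symmetry the cross terms x.(D y) and y.(D x) agree and cancel, so the quadratic form
  is additive and is represented by its values on unit vectors.\<close>

lemma dot_dg:
  assumes D: "symop D"
  shows "dot x (D x) = dot (dg D) x"
proof -
  have "dot x (D x) = dot (\<lambda>i. if i < n then dot (unit i) (D (unit i)) else 0) x"
  proof (rule additive_functional)
    fix x y
    show "dot (x + y) (D (x + y)) = dot x (D x) + dot y (D y)"
      by (simp add: symop_add[OF D] symop_adj[OF D, of y x] dot_commute[of "D y" x] ac_simps)
  next
    fix x y :: bvec assume *: "\<And>i. i < n \<Longrightarrow> x i = y i"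
    then have "D x = D y" by (auto simp: symop_eq_iff[OF D] intro: dot_local)
    then show "dot x (D x) = dot y (D y)" using * dot_local by metis
  qed
  also have "(\<lambda>i. if i < n then dot (unit i) (D (unit i)) else 0) = dg D"
    by (auto simp: dg_def dot_unit)
  finally show ?thesis .
qed

lemma dg_eqI:
  assumes "symop D" "v \<in> F" "\<And>x. dot x (D x) = dot v x"
  shows "dg D = v"
  by (rule F_eqI) (use assms dot_dg[OF assms(1)] in \<open>auto simp: dot_commute\<close>)

text \<open>The quadratic form vanishes on the kernel of \<open>D\<close>, so the diagonal is
  orthogonal to the kernel, whose complement is the range.\<close>

lemma dg_range:
  assumes D: "symop D"
  shows "dg D \<in> range D"
proof -
  have "dot (dg D) k = 0" if "D k = 0" for k using dot_dg[OF D, of k] that by simp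
  then show ?thesis unfolding symop_range_eq[OF D] by (simp add: perp_def)
qed

definition nonsing :: "(bvec \<Rightarrow> bvec) \<Rightarrow> bool" where
  "nonsing D \<longleftrightarrow> (\<forall>x\<in>F. x + D x = 0 \<longrightarrow> x = 0)"

text \<open>I + D and I + E are mutually inverse; keeping only D and E avoids the identity, which as an
  operator on all of \<^typ>\<open>bvec\<close> does not map into F.\<close>
definition inv_pair :: "(bvec \<Rightarrow> bvec) \<Rightarrow> (bvec \<Rightarrow> bvec) \<Rightarrow> bool" where
  "inv_pair D E \<longleftrightarrow> symop D \<and> symop E \<and> (\<forall>x. E (D x) = D x + E x) \<and> (\<forall>x. D (E x) = D x + E x)"

lemma inv_pair_swap: "inv_pair D E \<Longrightarrow> inv_pair E D"
  by (simp add: inv_pair_def add.commute)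

lemma inv_pair_nonsing:
  assumes "inv_pair D E"
  shows "nonsing D"
  unfolding nonsing_def
proof (intro ballI impI)
  fix x assume "x + D x = 0"
  then have "D x = x" using bvec_eq_iff[of x "D x"] by metis
  moreover have "E (D x) = D x + E x" using assms by (simp add: inv_pair_def)
  ultimately show "x = 0" by simp
qed

lemma nonsing_inv_pair:
  assumes D: "symop D" and ns: "nonsing D"
  shows "\<exists>E. inv_pair D E"
proof -
  define A where "A x = x + D x" for x
  have A_add: "A (x + y) = A x + A y" for x y
    by (simp add: A_def symop_add[OF D] ac_simps)
  have inj: "inj_on A F"
  proof (rule inj_onI)
    fix x y assume "x \<in> F" "y \<in> F" "A x = A y"
    then have "A (x + y) = 0" by (simp add: A_add)
    then have "x + y = 0" using ns \<open>x \<in> F\<close> \<open>y \<in> F\<close> by (auto simp: nonsing_def A_def)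
    then show "x = y" using bvec_eq_iff by blast
  qed
  have "A ` F \<subseteq> F" by (auto simp: A_def symop_F[OF D])
  then have surj: "A ` F = F" using endo_inj_surj[OF finite_F _ inj] by simp
  \<comment> \<open>In characteristic 2 the inverse of \<open>A\<close> plus I equals the inverse of
    \<open>A\<close> times (A + I), which is the inverse of \<open>A\<close> times \<open>D\<close>.
    Since \<open>D x\<close> lies in \<open>F\<close>, where \<open>A\<close> is bijective, this
    makes sense for every \<open>x\<close>.\<close>
  define E where "E x = inv_into F A (D x)" for x
  have EF: "E x \<in> F" and AE: "A (E x) = D x" for x
    unfolding E_def using symop_F[OF D, of x] surj f_inv_into_f[of "D x" A F]
    by (auto intro: inv_into_into)
  have uniq: "E x = y" if "y \<in> F" "A y = D x" for x y
    using inj_onD[OF inj] EF AE that by metis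
  have DE: "D (E x) = D x + E x" for x
    using AE[of x] unfolding A_def by (metis add.commute bvec_double(2))
  have E_add: "E (x + y) = E x + E y" for x y
    by (rule uniq) (simp_all add: EF A_add AE symop_add[OF D])
  have AD: "D (A x) = A (D x)" for x by (simp add: A_def symop_add[OF D])
  have ED: "E (D x) = D x + E x" for x
    by (rule uniq) (simp_all add: EF symop_F[OF D] A_add AE, simp add: A_def ac_simps)
  have A_adj: "dot u (A v) = dot (A u) v" for u v
    by (simp add: A_def symop_adj[OF D])
  have EA: "E (A x) = D x" for x
    by (simp add: A_def E_add ED)
  have E_local: "E u = E v" if "\<And>i. i < n \<Longrightarrow> u i = v i" for u v
  proof -
    have "D u = D v" using that by (auto simp: symop_eq_iff[OF D] intro: dot_local)
    then show ?thesis by (simp add: E_def)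
  qed
  \<comment> \<open>Arbitrary arguments need not be values of \<open>A\<close>, but their
    truncations lie in \<open>F\<close> and are. Neither side changes under truncation, so symmetry
    passes from \<open>A\<close> and \<open>D\<close> to \<open>E\<close>.\<close>
  have "dot x (E y) = dot (E x) y" for x y
  proof -
    let ?r = "\<lambda>x i. if i < n then x i else 0"
    have "?r u \<in> A ` F" for u unfolding surj by (auto simp: F_def)
    then have "\<exists>a. A a = ?r u" for u by (metis (no_types, lifting) image_iff)
    then obtain a b where ab: "A a = ?r x" "A b = ?r y" by blast
    have r: "E x = E (A a)" "E y = E (A b)"
      unfolding ab by (rule E_local, simp)+
    have "dot x (E y) = dot (A a) (E y)" "dot (E x) y = dot (E x) (A b)"
      unfolding ab dot_commute[of "E x"] by (rule dot_local, simp)+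
    moreover have "dot (A a) (E (A b)) = dot (E (A a)) (A b)"
      by (simp add: EA A_adj[symmetric] AD[symmetric] symop_adj[OF D, symmetric])
    ultimately show ?thesis by (simp only: r)
  qed
  then have "symop E" using E_add EF by (auto simp: symop_def)
  then show ?thesis using D ED DE by (auto simp: inv_pair_def)
qed

lemma inv_pair_range:
  assumes "inv_pair D E"
  shows "range E = range D"
proof -
  have "range E \<subseteq> range D" if "inv_pair D E" for D E
  proof
    fix v assume "v \<in> range E"
    then obtain x where "v = E x" by auto
    then have "v = D (x + E x)" using that by (simp add: inv_pair_def symop_add)
    then show "v \<in> range D" by auto
  qed
  then show ?thesis using assms inv_pair_swap by blast
qed

lemma inv_pair_eq_iff:
  assumes "inv_pair D E"
  shows "E x = E y \<longleftrightarrow> D x = D y"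
proof -
  have "symop D" "symop E" using assms by (simp_all add: inv_pair_def)
  then show ?thesis by (simp only: symop_eq_iff inv_pair_range[OF assms])
qed

text \<open>Pair with \<open>x\<close>. On the left (D x).1 = (D x).(D x); on the right, the
  quadratic form of \<open>E\<close> at \<open>D x\<close> yields the same term plus x.(D x) and
  x.(E x), which are the contributions of the two diagonals. This ties the diagonals to the weight
  functional, and most case distinctions of the descent rest on it.\<close>

lemma image_ones:
  assumes "inv_pair D E"
  shows "D ones = dg D + dg E + D (dg E)"
proof (rule F_eqI)
  have D: "symop D" and E: "symop E" and ED: "\<And>x. E (D x) = D x + E x"
    and DE: "\<And>x. D (E x) = D x + E x" using assms by (auto simp: inv_pair_def)
  show "D ones \<in> F" "dg D + dg E + D (dg E) \<in> F" using D by (auto simp: symop_F)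
  fix x
  have 1: "dot x (D ones) = dot (D x) (D x)"
    using symop_adj[OF D, of ones x] dot_ones[of "D x"] by (simp add: dot_commute)
  have 2: "dot x (D (dg E)) = dot (D x) (D x) + dot x (D x) + dot x (E x)"
  proof -
    have "dot x (D (dg E)) = dot (D x) (E (D x))"
      using dot_dg[OF E, of "D x"] symop_adj[OF D, of "dg E" x] by (simp add: dot_commute)
    also have "\<dots> = dot (D x) (D x) + dot x (D (E x))" by (simp add: ED symop_adj[OF D])
    finally show ?thesis by (simp add: DE ac_simps)
  qed
  show "dot x (D ones) = dot x (dg D + dg E + D (dg E))"
    by (simp add: 1 2 dot_commute[of x "dg D"] dot_commute[of x "dg E"] dot_dg[OF D, symmetric]
        dot_dg[OF E, symmetric] ac_simps)
qed

section \<open>Rank-one updates x x' and their effect on inverse, diagonal and column space\<close>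

definition upd :: "(bvec \<Rightarrow> bvec) \<Rightarrow> bvec \<Rightarrow> bvec \<Rightarrow> bvec" where
  "upd D x = (\<lambda>y. D y + scl (dot x y) x)"

lemma symop_upd:
  assumes "symop D" "x \<in> F"
  shows "symop (upd D x)"
proof -
  have "dot y x * dot z x = dot x z * dot x y" for y z
    by (simp add: dot_commute mult.commute)
  then show ?thesis using assms unfolding symop_def upd_def
    by (auto simp: scl_add dot_commute[of _ x] ac_simps)
qed

lemma upd_upd [simp]: "upd (upd D x) x = D"
  by (auto simp: upd_def add.assoc)

lemma dg_upd:
  assumes "symop D" "x \<in> F"
  shows "dg (upd D x) = dg D + x"
proof (rule dg_eqI)
  fix y
  have "dot y x * dot y x = dot y x" by (cases "dot y x") simp_all
  then show "dot y (upd D x y) = dot (dg D + x) y"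
    using dot_dg[OF assms(1), of y] by (simp add: upd_def dot_commute[of x y])
qed (use assms symop_upd in auto)

text \<open>Sherman-Morrison: \<open>w\<close> is the inverse of I + D applied to \<open>x\<close>,
  and the denominator 1 + x.w is 1 exactly under the last assumption; its only other value 0 is the
  singular case.\<close>

lemma inv_pair_upd:
  assumes p: "inv_pair D E" and x: "x \<in> F" and w: "w = x + E x" and xw: "dot x w = 0"
  shows "inv_pair (upd D x) (upd E w)"
proof -
  have D: "symop D" and E: "symop E" and ED: "\<And>x. E (D x) = D x + E x"
    and DE: "\<And>x. D (E x) = D x + E x" using p by (auto simp: inv_pair_def)
  have wF: "w \<in> F" using w x E by (auto simp: symop_F)
  have xw': "x = w + D w" by (simp add: w symop_add[OF D] DE ac_simps)
  have xE: "dot x (E y) = dot w y + dot x y" for y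
    by (simp add: w symop_adj[OF E] ac_simps)
  have DW: "D w = x + w" by (metis add.commute bvec_double(2) xw')
  have wD: "dot w (D y) = dot x y + dot w y" for y
    by (simp add: symop_adj[OF D] DW)
  have EX: "E x = w + x" by (simp add: w add.commute)
  have "upd E w (upd D x y) = upd D x y + upd E w y" for y
    unfolding upd_def
    by (simp add: symop_add[OF E] symop_scl[OF E] ED wD xw dot_commute[of w x] EX scl_add ac_simps)
  moreover have "upd D x (upd E w y) = upd D x y + upd E w y" for y
    unfolding upd_def
    by (simp add: symop_add[OF D] symop_scl[OF D] DE xE xw DW scl_add ac_simps)
  ultimately show ?thesis using symop_upd[OF D x] symop_upd[OF E wF] by (simp add: inv_pair_def)
qed

text \<open>A path of length k from I + D to I in the graph.\<close>
inductive conn :: "nat \<Rightarrow> (bvec \<Rightarrow> bvec) \<Rightarrow> bool" where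
  conn_zero: "conn 0 (\<lambda>_. 0)"
| conn_Suc: "conn k (upd D x) \<Longrightarrow> symop D \<Longrightarrow> nonsing D \<Longrightarrow> x \<in> F \<Longrightarrow> x \<noteq> 0 \<Longrightarrow> conn (Suc k) D"

text \<open>The update is \<open>D\<close> composed with y |-> y + ((D z).y) z, which projects onto
  the vectors orthogonal to \<open>D z\<close> because z.(D z) = 1. The functional \<open>z\<close>
  vanishes on the new range, so exactly one dimension is lost.\<close>

lemma range_upd_hyperplane:
  assumes D: "symop D" and z: "dot (dg D) z = 1"
  shows "range (upd D (D z)) = {v \<in> range D. dot z v = 0}"
    and "card (range D) = 2 * card (range (upd D (D z)))"
proof -
  have zz: "dot z (D z) = 1" using z dot_dg[OF D] by simp
  show *: "range (upd D (D z)) = {v \<in> range D. dot z v = 0}"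
  proof (intro equalityI subsetI)
    fix v assume "v \<in> range (upd D (D z))"
    then obtain y where v: "v = upd D (D z) y" by auto
    then have "v = D (y + scl (dot (D z) y) z)"
      by (simp add: upd_def symop_add[OF D] symop_scl[OF D])
    moreover have "dot z v = 0" using v zz by (simp add: upd_def symop_adj[OF D, of z y])
    ultimately show "v \<in> {v \<in> range D. dot z v = 0}" by simp
  next
    fix v assume "v \<in> {v \<in> range D. dot z v = 0}"
    then obtain y where "v = D y" "dot z (D y) = 0" by auto
    then have "v = upd D (D z) y" by (simp add: upd_def symop_adj[OF D, of z y])
    then show "v \<in> range (upd D (D z))" by auto
  qed
  show "card (range D) = 2 * card (range (upd D (D z)))"
    unfolding * by (rule card_hyperplane[OF symop_range[OF D] _ zz]) simp
qed

text \<open>The kernel is unchanged: if D y = ((D z).y) D z, pairing with \<open>z\<close> and z.(D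
  z) = 0 makes the coefficient vanish. Such neutral steps shift the diagonal by \<open>D z\<close>
  at constant rank.\<close>

lemma range_upd_same:
  assumes D: "symop D" and z: "dot (dg D) z = 0"
  shows "range (upd D (D z)) = range D"
proof -
  have zz: "dot z (D z) = 0" using z dot_dg[OF D] by simp
  have "upd D (D z) y = 0 \<longleftrightarrow> D y = 0" for y
  proof
    assume "upd D (D z) y = 0"
    then have *: "D y = scl (dot (D z) y) (D z)" by (simp add: upd_def bvec_eq_iff[of "D y"])
    then have "dot z (D y) = 0" by (simp add: zz)
    then have "dot (D z) y = 0" by (simp add: symop_adj[OF D, of z])
    then show "D y = 0" using * by simp
  next
    assume "D y = 0"
    then have "dot (D z) y = 0" using symop_adj[OF D, of z y] by simp
    then show "upd D (D z) y = 0" using \<open>D y = 0\<close> by (simp add: upd_def)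
  qed
  then show ?thesis using symop_range_eq[OF D] symop_range_eq[OF symop_upd[OF D symop_F[OF D]]] by simp
qed


section \<open>Short paths\<close>

text \<open>Equivalently, appending a parity bit makes V a self-orthogonal code.\<close>
definition special :: "bvec set \<Rightarrow> bool" where
  "special V \<longleftrightarrow> (\<forall>u\<in>V. \<forall>v\<in>V. dot u v = dot ones u * dot ones v)"

lemma inv_pairD:
  assumes "inv_pair D E"
  shows "symop D" "symop E" "E (D x) = D x + E x" "D (E x) = D x + E x"
  using assms by (auto simp: inv_pair_def)

lemma separating_vector:
  assumes "u \<in> F" "v \<in> F" "u \<noteq> 0" "v \<noteq> 0"
  shows "\<exists>z. dot u z = 1 \<and> dot v z = 1"
proof -
  obtain a where a: "dot u a = 1"
    using nondegenerate[OF assms(1)] assms(3) by (force simp: dot_commute)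
  obtain b where b: "dot v b = 1"
    using nondegenerate[OF assms(2)] assms(4) by (force simp: dot_commute)
  show ?thesis
  proof (cases "dot v a = 1 \<or> dot u b = 1")
    case True
    then show ?thesis using a b by auto
  next
    case False
    then have "dot u (a + b) = 1" "dot v (a + b) = 1" using a b by auto
    then show ?thesis by blast
  qed
qed

text \<open>For x = D z the vector x + E x of the Sherman-Morrison formula is \<open>E z\<close>,
  and (D z).(E z) = z.(D z) + z.(E z). Hence invertibility survives when \<open>z\<close> has equal
  products with the two diagonals, and the step treats \<open>D\<close> and \<open>E\<close>
  alike.\<close>

lemma inv_pair_step:
  assumes ip: "inv_pair D E" and z: "dot (dg D) z = dot (dg E) z"
  shows "inv_pair (upd D (D z)) (upd E (E z))"
    and "dg (upd D (D z)) = dg D + D z" and "dg (upd E (E z)) = dg E + E z"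
    and "D z \<noteq> 0 \<Longrightarrow> conn k (upd D (D z)) \<Longrightarrow> conn (Suc k) D"
proof -
  note D = inv_pairD(1)[OF ip] and E = inv_pairD(2)[OF ip]
  have "dot (D z) (E z) = dot z (D (E z))" by (simp add: symop_adj[OF D])
  also have "\<dots> = 0" using z by (simp add: inv_pairD[OF ip] dot_dg[OF D] dot_dg[OF E])
  finally show "inv_pair (upd D (D z)) (upd E (E z))"
    by (intro inv_pair_upd[OF ip]) (simp_all add: symop_F[OF D] inv_pairD[OF ip])
  show "dg (upd D (D z)) = dg D + D z" "dg (upd E (E z)) = dg E + E z"
    by (simp_all add: dg_upd D E symop_F[OF D] symop_F[OF E])
  show "conn k (upd D (D z)) \<Longrightarrow> D z \<noteq> 0 \<Longrightarrow> conn (Suc k) D"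
    using inv_pair_nonsing[OF ip] D symop_F[OF D] by (auto intro: conn_Suc)
qed

text \<open>Counted are the values \<open>D z\<close>, not the vectors \<open>z\<close>. Since u = D
  a, the condition on u.z is a linear condition a.(D z) on the value, so the set is a fibre inside
  the column space.\<close>

lemma card_classes_two:
  assumes D: "symop D" and "u \<in> range D" "v \<in> range D" "u \<noteq> 0" "v \<noteq> 0"
  shows "card (range D) \<le> 4 * card {D z |z. dot u z = 1 \<and> dot v z = 1}"
proof -
  obtain a b where ab: "u = D a" "v = D b" using assms by auto
  have *: "dot a (D z) = dot u z" "dot b (D z) = dot v z" for z
    by (simp_all add: ab symop_adj[OF D])
  obtain z where "dot u z = 1" "dot v z = 1"
    using separating_vector[of u v] assms symop_F[OF D] by auto
  then have "card (range D) \<le> 4 * card {w \<in> range D. dot a w = 1 \<and> dot b w = 1}"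
    by (intro card_codim_two[OF symop_range[OF D], of "D z"]) (auto simp: *)
  also have "{w \<in> range D. dot a w = 1 \<and> dot b w = 1} = {D z |z. dot u z = 1 \<and> dot v z = 1}"
    by (auto simp: *)
  finally show ?thesis .
qed

lemma card_classes_one:
  assumes D: "symop D" and "u \<in> range D" "u \<noteq> 0"
  shows "card (range D) = 2 * card {D z |z. dot u z = 1}"
proof -
  obtain a where a: "u = D a" using assms by auto
  have *: "dot a (D z) = dot u z" for z
    by (simp add: a symop_adj[OF D])
  obtain z where "dot u z = 1"
    using separating_vector[of u u] assms symop_F[OF D] by auto
  then have "card (range D) = 2 * card {w \<in> range D. dot a w = 1}"
    using card_hyperplane[OF symop_range[OF D], of "D z" a]
      card_fibre[OF symop_range[OF D], of "D z" a] by (simp add: *)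
  also have "{w \<in> range D. dot a w = 1} = {D z |z. dot u z = 1}"
    by (auto simp: *)
  finally show ?thesis .
qed

lemma finite_classes [simp]: "symop D \<Longrightarrow> finite {D z |z. P z}"
  by (rule finite_subset[OF _ subspaceD(4)[OF symop_range]]) auto

lemma symop_card_one:
  assumes D: "symop D" and "card (range D) = 1"
  shows "D = (\<lambda>_. 0)"
proof -
  have "range D = {0}"
    using assms(2) subspaceD(2)[OF symop_range[OF D]] by (metis card_1_singletonE singletonD)
  then show ?thesis by (metis rangeI singletonD)
qed

text \<open>An alternating form cannot have rank one: if y = D u spans the range, then u.y = 0, and
  each w.y = (D w).u is 0 because \<open>D w\<close> is a multiple of \<open>y\<close>.\<close>

lemma dg_rank_one:
  assumes D: "symop D" and "card (range D) = 2"
  shows "dg D \<noteq> 0"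
proof
  assume dg: "dg D = 0"
  obtain y where y: "range D = {0, y}" "y \<noteq> 0"
    using assms(2) subspaceD(2)[OF symop_range[OF D]]
    by (metis card_2_iff doubleton_eq_iff insertE singletonD)
  then obtain u where u: "D u = y" by (metis insertI1 insert_commute rangeE)
  have uu: "dot u y = 0" using dot_dg[OF D, of u] dg u by simp
  have "y = 0"
  proof (rule nondegenerate)
    fix w
    have "dot w y = dot (D w) u" using symop_adj[OF D, of w u] u by simp
    moreover have "D w = 0 \<or> D w = y" using y by auto
    ultimately show "dot w y = 0" using uu by (auto simp: dot_commute)
  qed (use u symop_F[OF D] in auto)
  then show False using y by simp
qed

lemma conn_rank_one:
  assumes ip: "inv_pair D E" and c: "card (range D) = 2"
  shows "conn 1 D"
proof -
  note D = inv_pairD(1)[OF ip] and E = inv_pairD(2)[OF ip]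
  have "dg D \<noteq> 0" "dg E \<noteq> 0"
    using dg_rank_one[OF D c] dg_rank_one[OF E] c inv_pair_range[OF ip] by auto
  then obtain z where z: "dot (dg D) z = 1" "dot (dg E) z = 1"
    using separating_vector by (metis dg_F)
  have "D z \<noteq> 0" using z(1) dot_dg[OF D, of z] by auto
  moreover have "upd D (D z) = (\<lambda>_. 0)"
    using range_upd_hyperplane(2)[OF D z(1)] c
    by (intro symop_card_one symop_upd D symop_F[OF D]) simp
  ultimately show ?thesis using inv_pair_step(4)[OF ip, of z 0] z conn_zero by simp
qed

text \<open>With D 1 = 0, \<open>image_ones\<close> says that the diagonal of \<open>D\<close> is I
  + D applied to that of \<open>E\<close>, so both are nonzero together, and the condition persists
  since (D z).1 = z.(D 1). Only the value D z = dg D is to be avoided; from rank 3 on there are at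
  least two admissible values, and rank one is settled by \<open>conn_rank_one\<close>.\<close>

lemma conn_ones_kernel:
  assumes "inv_pair D E" "card (range D) = 2 ^ r" "D ones = 0" "dg D \<noteq> 0"
  shows "conn r D"
  using assms
proof (induction r arbitrary: D E)
  case 0
  then have "D = (\<lambda>_. 0)" using inv_pairD symop_card_one by auto
  then show ?case using conn_zero by (simp only:)
next
  case (Suc r)
  note ip = Suc.prems(1)
  note D = inv_pairD(1)[OF ip] and E = inv_pairD(2)[OF ip]
  have dg: "dg D = dg E + D (dg E)"
    using image_ones[OF ip] Suc.prems(3) bvec_eq_iff[of "dg D" "dg E + D (dg E)"]
    by (simp only: add.assoc)
  have e0: "dg E \<noteq> 0" using dg Suc.prems(4) symop_zero[OF D] by (metis add.right_neutral)
  have eR: "dg E \<in> range D" using dg_range[OF E] inv_pair_range[OF ip] by simp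
  have "\<exists>z. dot (dg D) z = 1 \<and> dot (dg E) z = 1 \<and> (2 \<le> r \<longrightarrow> D z \<noteq> dg D)"
  proof (cases "2 \<le> r")
    case True
    let ?W = "{D z |z. dot (dg D) z = 1 \<and> dot (dg E) z = 1}"
    have "2 ^ Suc r \<le> 4 * card ?W"
      using card_classes_two[OF D dg_range[OF D] eR] Suc.prems(2,4) e0 by simp
    moreover have "(2::nat) ^ 3 \<le> 2 ^ Suc r" using True by (intro power_increasing) auto
    ultimately have "1 < card ?W" by simp
    then have "\<not> ?W \<subseteq> {dg D}" using card_mono[of "{dg D}" ?W] by auto
    then show ?thesis by blast
  next
    case False
    then show ?thesis using separating_vector[of "dg D" "dg E"] e0 Suc.prems(4) by auto
  qed
  then obtain z where z: "dot (dg D) z = 1" "dot (dg E) z = 1" "2 \<le> r \<Longrightarrow> D z \<noteq> dg D" by blast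
  let ?D = "upd D (D z)"
  have zeq: "dot (dg D) z = dot (dg E) z" using z by simp
  note st = inv_pair_step[OF ip zeq]
  have card: "card (range ?D) = 2 ^ r"
    using range_upd_hyperplane(2)[OF D z(1)] Suc.prems(2) by simp
  have "D z \<noteq> 0" using z(1) dot_dg[OF D, of z] by auto
  moreover have "conn r ?D"
  proof -
    consider "r = 0" | "r = 1" | "2 \<le> r" by linarith
    then show ?thesis
    proof cases
      case 1
      then have "?D = (\<lambda>_. 0)" using symop_card_one[OF inv_pairD(1)[OF st(1)]] card by simp
      then show ?thesis using 1 conn_zero by (simp only:)
    next
      case 2
      then show ?thesis using conn_rank_one[OF st(1)] card by simp
    next
      case 3
      have "?D ones = 0"
        using Suc.prems(3) symop_adj[OF D, of z ones] by (simp add: upd_def)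
      moreover have "dg ?D \<noteq> 0" using st(2) z(3)[OF 3] bvec_eq_iff[of "dg D" "D z"] by auto
      ultimately show ?thesis using Suc.IH[OF st(1) card] by simp
    qed
  qed
  ultimately show ?case using st(4) by simp
qed

text \<open>On the plane spanned by \<open>u\<close> and \<open>w\<close>, the determinant of I + D
  is 1 + u.w + (u.u)(w.w), so invertibility amounts to the vanishing of the form that defines
  \<open>special\<close>. If the form is nonzero, one of \<open>u\<close>, \<open>w\<close>,
  \<open>u + w\<close> is fixed by \<open>D\<close>.\<close>

lemma special_rank_two:
  assumes D: "symop D" and ns: "nonsing D" and c: "card (range D) = 4" and dg: "dg D = 0"
  shows "special (range D)"
proof (rule ccontr)
  note V = subspaceD[OF symop_range[OF D]]
  assume "\<not> special (range D)"
  then obtain u w where uw: "u \<in> range D" "w \<in> range D" and b: "dot u w \<noteq> dot ones u * dot ones w"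
    by (auto simp: special_def)
  have ne: "u \<noteq> 0" "w \<noteq> 0" using b by auto
  have ne': "u \<noteq> w"
  proof
    assume "u = w"
    then show False using b dot_ones[of w] by (cases "dot w w") auto
  qed
  have sub: "{0, u, w, u + w} \<subseteq> range D" using uw V by auto
  have "u + w \<noteq> 0" "u + w \<noteq> u" "u + w \<noteq> w" using ne ne' bvec_eq_iff[of u w] by auto
  then have "card {0, u, w, u + w} = 4" using ne ne' by (simp add: card_insert_if)
  then have R: "range D = {0, u, w, u + w}" using card_seteq[OF V(4) sub] c by simp
  obtain a b' where a: "u = D a" and b': "w = D b'" using uw by auto
  have alt: "dot x (D x) = 0" for x using dot_dg[OF D, of x] dg by simp
  have au: "dot a u = 0" and bw: "dot b' w = 0" using alt a b' by auto
  have aw: "dot a w = dot b' u"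
    using symop_adj[OF D, of a b'] by (simp add: a b' dot_commute)
  have "dot a w = 1"
  proof (rule ccontr)
    assume "dot a w \<noteq> 1"
    then have "D a = D 0" unfolding symop_eq_iff[OF D] R using au by auto
    then show False using ne a symop_zero[OF D] by simp
  qed
  then have vals: "dot a w = 1" "dot b' u = 1" using aw by auto
  have expand: "y = scl (dot b' y) u + scl (dot a y) w" if "y \<in> range D" for y
    using that unfolding R by (auto simp: au bw vals)
  have Du: "D u = scl (dot u w) u + scl (dot ones u) w"
    using expand[of "D u"] symop_adj[OF D, of b' u] symop_adj[OF D, of a u]
    by (simp add: a[symmetric] b'[symmetric] dot_ones dot_commute[of w u])
  have Dw: "D w = scl (dot ones w) u + scl (dot u w) w"
    using expand[of "D w"] symop_adj[OF D, of b' w] symop_adj[OF D, of a w]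
    by (simp add: a[symmetric] b'[symmetric] dot_ones dot_commute[of w u])
  have fp: "x = 0" if "x \<in> range D" "D x = x" for x
    using ns that(2) symop_F[OF D, of x] by (simp add: nonsing_def)
  consider "dot ones u = 0" | "dot ones w = 0" | "dot ones u = 1" "dot ones w = 1"
    by (cases "dot ones u"; cases "dot ones w") auto
  then show False
  proof cases
    case 1
    then have "dot u w = 1" using b by simp
    then show False using fp[OF uw(1)] Du 1 ne by simp
  next
    case 2
    then have "dot u w = 1" using b by simp
    then show False using fp[OF uw(2)] Dw 2 ne by simp
  next
    case 3
    then have "dot u w = 0" using b by simp
    then have "D (u + w) = u + w" using Du Dw 3 by (simp add: symop_add[OF D] add.commute)
    then show False using fp sub \<open>u + w \<noteq> 0\<close> by blast
  qed
qed

text \<open>The alternating form b(u,v) = u.v + (u.u)(v.v) is nonzero on \<open>V\<close> but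
  vanishes on both hyperplanes, hence b(u,v) = p(u) q(v) + q(u) p(v); the conclusion is its value at
  u = d. Thus two special hyperplanes determine the functional p + q on \<open>V\<close> through
  \<open>d\<close> alone.\<close>

lemma hyperplane_special_pair:
  assumes V: "subspace V" and nsp: "\<not> special V"
    and p: "special {v \<in> V. dot p v = 0}" and q: "special {v \<in> V. dot q v = 0}"
    and d: "d \<in> V" "dot p d = 1" "dot q d = 1"
    and ne: "\<exists>v\<in>V. dot p v \<noteq> dot q v"
    and v: "v \<in> V"
  shows "dot d v + dot ones d * dot ones v = dot p v + dot q v"
proof -
  define b where "b u v = dot u v + dot ones u * dot ones v" for u v
  have b_add: "b (u + u') v = b u v + b u' v" "b v (u + u') = b v u + b v u'" for u u' v
    by (simp_all add: b_def algebra_simps)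
  have b_scl: "b (scl c u) v = c * b u v" "b v (scl c u) = c * b v u" for c u v
    by (cases c; simp add: b_def)+
  have b_comm: "b u v = b v u" for u v by (simp add: b_def dot_commute mult.commute)
  have b_self: "b u u = 0" for u
    by (cases "dot u u") (simp_all add: b_def dot_ones)
  have bp: "b u v = 0" if "u \<in> V" "v \<in> V" "dot p u = 0" "dot p v = 0" for u v
    using p that by (simp add: special_def b_def)
  have bq: "b u v = 0" if "u \<in> V" "v \<in> V" "dot q u = 0" "dot q v = 0" for u v
    using q that by (simp add: special_def b_def)
  obtain v1 where v1: "v1 \<in> V" "dot p v1 \<noteq> dot q v1" using ne by auto
  \<comment> \<open>Corrected by \<open>d\<close> to lie in the kernel of \<open>p\<close> but not
    of \<open>q\<close>; \<open>d\<close> and \<open>v0\<close> span a complement of the common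
    kernel, so b is determined by its single value b(d,v0).\<close>
  define v0 where "v0 = v1 + scl (dot p v1) d"
  have v0: "v0 \<in> V" "dot p v0 = 0" "dot q v0 = 1"
    using v1 d subspaceD(3)[OF V] subspace_scl[OF V] unfolding v0_def
    by (cases "dot p v1"; cases "dot q v1"; auto)+
  have dv0: "d + v0 \<in> V" using d v0 subspaceD(3)[OF V] by blast
  have dy: "b d y = 0" if y: "y \<in> V" "dot p y = 0" "dot q y = 0" for y
  proof -
    have "b v0 y = 0" using bp y v0 by simp
    moreover have "b (d + v0) y = 0" using bq[OF dv0] y d v0 by simp
    ultimately show ?thesis by (simp add: b_add)
  qed
  have dec: "\<exists>y\<in>V. dot p y = 0 \<and> dot q y = 0 \<and> v = y + scl (dot p v) d + scl (dot p v + dot q v) v0"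
    if "v \<in> V" for v
  proof
    let ?y = "v + scl (dot p v) d + scl (dot p v + dot q v) v0"
    show "?y \<in> V" using that d v0 subspaceD(3)[OF V] subspace_scl[OF V] by simp
    show "dot p ?y = 0 \<and> dot q ?y = 0 \<and> v = ?y + scl (dot p v) d + scl (dot p v + dot q v) v0"
      using d v0 by (simp add: ac_simps)
  qed
  have dv: "b d v0 = 1"
  proof (rule ccontr)
    assume "b d v0 \<noteq> 1"
    then have z: "b d v0 = 0" "b v0 d = 0" by (simp_all add: b_comm[of v0])
    have "b u v = 0" if "u \<in> V" "v \<in> V" for u v
    proof -
      obtain y where y: "y \<in> V" "dot p y = 0" "dot q y = 0"
        "u = y + scl (dot p u) d + scl (dot p u + dot q u) v0" using dec[OF \<open>u \<in> V\<close>] by blast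
      obtain y' where y': "y' \<in> V" "dot p y' = 0" "dot q y' = 0"
        "v = y' + scl (dot p v) d + scl (dot p v + dot q v) v0" using dec[OF \<open>v \<in> V\<close>] by blast
      have "b y y' = 0" "b y v0 = 0" "b v0 y' = 0" "b d y' = 0" "b y d = 0"
        using bp dy y y' v0 b_comm[of y d] by auto
      then show ?thesis
        by (subst y(4), subst y'(4)) (simp add: b_add b_scl b_self z)
    qed
    then show False using nsp by (auto simp: special_def b_def bit_sum_eq_iff)
  qed
  obtain y where y: "y \<in> V" "dot p y = 0" "dot q y = 0"
    "v = y + scl (dot p v) d + scl (dot p v + dot q v) v0" using dec[OF v] by blast
  have "b d v = b d y + dot p v * b d d + (dot p v + dot q v) * b d v0"
    by (subst y(4)) (simp only: b_add b_scl)
  then show ?thesis using dy y dv b_self by (simp add: b_def)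
qed

text \<open>D identifies z with z' iff they agree on V, so Z says that
  only two functionals take the value 1 on both diagonals.\<close>
lemma no_asymmetric_pair:
  assumes ip: "inv_pair D E" and d: "d = dg D" "d \<noteq> 0" and e: "e = dg E" "e \<noteq> 0"
    and p: "dot d p = 1" "dot e p = 1" and q: "dot d q = 1" "dot e q = 1" and ne: "D p \<noteq> D q"
    and Z: "\<And>z. dot d z = 1 \<Longrightarrow> dot e z = 1 \<Longrightarrow> D z = D p \<or> D z = D q"
    and hd: "D d + scl (dot ones d) (D ones) = D p + D q"
    and he: "D e + scl (dot ones e) (D ones) = D p + D q"
    and od: "dot ones d = 0" and oe: "dot ones e = 1"
  shows False
proof -
  note D = inv_pairD(1)[OF ip] and E = inv_pairD(2)[OF ip]
  note ED = inv_pairD(3)[OF ip]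
  have Dd: "D d = D p + D q" using hd od by simp
  have Do: "D ones = d + e + D e" using image_ones[OF ip] d e by simp
  have Eo: "E ones = e + d + E d" using image_ones[OF inv_pair_swap[OF ip]] d e by simp
  have "D e + (d + e + D e) = D p + D q" using he oe Do by simp
  then have Dd': "D d = d + e" using Dd by (simp add: ac_simps)
  have dR: "d \<in> range D" using d dg_range[OF D] by simp
  \<comment> \<open>The subcase in which \<open>d\<close> is itself one of the two values;
    \<open>p\<close> and \<open>q\<close> are generalised so that it serves both orders.\<close>
  have aux: False if p: "dot d p = 1" "dot e p = 1" and q: "dot d q = 1" "dot e q = 1"
    and ne: "D p \<noteq> D q" and Dd: "D d = D p + D q"
    and Z: "\<And>z. dot d z = 1 \<Longrightarrow> dot e z = 1 \<Longrightarrow> D z = D p \<or> D z = D q"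
    and Dp: "D p = d" for p q
  proof -
    have "d + D q = d + e" using Dd Dd' Dp by simp
    then have Dq: "D q = e" by simp
    have ee: "e = d + D d" using Dd' by simp
    have "E e = D d" using arg_cong[OF ee, of E] by (simp add: symop_add[OF E] ED ac_simps)
    moreover have "E e = e + E q" using ED[of q] Dq by simp
    ultimately have "E q = e + D d" by (metis bvec_double(2))
    then have Eq: "E q = d" using Dd' by (simp add: ac_simps)
    have Ed: "E d = d + E p" using ED[of p] Dp by simp
    have Eo': "E ones = e + E p" using Eo Ed by (simp add: ac_simps)
    \<comment> \<open>This vector is annihilated by \<open>p\<close>, \<open>q\<close> and 1. These
      suffice to annihilate everything, which yields E p = d = E q.\<close>
    define v where "v = E p + d"
    have pp: "dot p (E p) = 1" using dot_dg[OF E, of p] e p by simp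
    have pv: "dot p v = 0" using pp p by (simp add: v_def dot_commute[of p d])
    have "dot q (E p) = 1" using symop_adj[OF E, of q p] Eq p by simp
    then have qv: "dot q v = 0" using q by (simp add: v_def dot_commute[of q d])
    have "dot ones (E p) = 0"
      using symop_adj[OF E, of ones p] Eo' p pp by (simp add: dot_commute[of "E p" p])
    then have ov: "dot ones v = 0" using od by (simp add: v_def)
    have vR: "v \<in> range D"
      unfolding v_def using dR inv_pair_range[OF ip]
      by (intro subspaceD(3)[OF symop_range[OF D]]) auto
    have "v = 0"
    proof (rule nondegenerate)
      show "v \<in> F" using vR symop_F[OF D] by auto
      fix y
      \<comment> \<open>Adding \<open>p\<close> repairs the product with \<open>d\<close>; adding 1
        repairs the product with \<open>e\<close> without disturbing \<open>d\<close>, as 1.d = 0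
        and 1.e = 1. By \<open>Z\<close> the result acts on V like \<open>p\<close> or
        \<open>q\<close>, so it annihilates \<open>v\<close>, and so does \<open>y\<close>.\<close>
      define y1 where "y1 = y + scl (dot d y + 1) p"
      define y2 where "y2 = y1 + scl (dot e y1 + 1) ones"
      have "dot d y1 = 1" by (simp add: y1_def p algebra_simps)
      then have "dot d y2 = 1" by (simp add: y2_def dot_commute[of d ones] od)
      moreover have "dot e y2 = 1" by (simp add: y2_def dot_commute[of e ones] oe)
      ultimately have "D y2 = D p \<or> D y2 = D q" using Z by blast
      then have "dot y2 v = 0" using vR pv qv symop_eq_iff[OF D] by metis
      then show "dot y v = 0" by (simp add: y2_def y1_def pv ov)
    qed
    then have "E p = E q" using bvec_eq_iff[of "E p" d] Eq by (simp add: v_def)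
    then show False using ne inv_pair_eq_iff[OF ip] by simp
  qed
  \<comment> \<open>From z0.(D d) = d.d = 0 and D d = d + e, the products of \<open>z0\<close> with
    \<open>d\<close> and \<open>e\<close> agree. If both are 1, then \<open>d\<close> is one of the
    two values; if both are 0, then p + z0 is a further candidate and forces D d = d, hence e =
    0.\<close>
  obtain z0 where z0: "D z0 = d" using dR by auto
  have "dot z0 (D d) = 0" using symop_adj[OF D, of z0 d] z0 od dot_ones by simp
  then have zz: "dot e z0 = dot d z0"
    using Dd' by (simp add: dot_commute[of z0] bit_sum_eq_iff)
  show False
  proof (cases "dot d z0 = 1")
    case True
    then have "d = D p \<or> d = D q" using Z[of z0] zz z0 by simp
    then show False
    proof
      assume "d = D p"
      then have "D p = d" by (rule sym)
      show False by (rule aux[OF p q ne Dd Z \<open>D p = d\<close>])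
    next
      assume "d = D q"
      then have "D q = d" by (rule sym)
      have Dd'': "D d = D q + D p" using Dd by (simp only: add.commute)
      have Z': "D z = D q \<or> D z = D p" if "dot d z = 1" "dot e z = 1" for z using Z that by blast
      show False by (rule aux[OF q p ne[symmetric] Dd'' Z' \<open>D q = d\<close>])
    qed
  next
    case False
    then have "dot d z0 = 0" "dot e z0 = 0" using zz by simp_all
    then have "D (z0 + p) = D p \<or> D (z0 + p) = D q" using p by (intro Z) simp_all
    then have "d + D p = D p \<or> d + D p = D q" using z0 by (simp add: symop_add[OF D])
    then show False
    proof
      assume "d + D p = D p"
      then show False using d by simp
    next
      assume "d + D p = D q"
      then have "D d = d" using Dd by (metis add.commute bvec_double(2))
      then show False using Dd' e by simp
    qed
  qed
qed


text \<open>The descent fails for z only if D z is one of four vectors: two that make a diagonal vanish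
  and, by \<open>hyperplane_special_pair\<close>, at most two that make the hyperplane special. Counting the
  admissible D z leaves ranks 3 and 4, where the extremal configuration is contradictory.\<close>
lemma good_step:
  assumes ip: "inv_pair D E" and d: "d = dg D" "d \<noteq> 0" and e: "e = dg E" "e \<noteq> 0"
    and c: "card (range D) = 2 ^ r" and r: "3 \<le> r" and o: "D ones \<noteq> 0"
    and no: "\<not> (dot ones d = 1 \<and> dot ones e = 1)" and nsp: "\<not> special (range D)"
  shows "\<exists>z. dot d z = 1 \<and> dot e z = 1 \<and> \<not> special {v \<in> range D. dot z v = 0}
           \<and> (r = 3 \<or> D z \<noteq> d \<and> E z \<noteq> e)"
proof (rule ccontr)
  assume neg: "\<not> ?thesis"
  note D = inv_pairD(1)[OF ip] and E = inv_pairD(2)[OF ip]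
  let ?W = "{D z |z. dot d z = 1 \<and> dot e z = 1}"
  \<comment> \<open>The values \<open>D z\<close> at which a diagonal dies: D z = d for
    \<open>D\<close>, and E z = e for \<open>E\<close>, which \<open>image_ones\<close> rewrites as
    D z = d + D 1. From rank 3 the step leads to rank 2, where \<open>special_rank_two\<close>
    protects the diagonals of a space that is not special.\<close>
  define X where "X = (if r = 3 then {} else {d, d + D ones})"
  have Do: "D ones = d + e + D e" using image_ones[OF ip] d e by simp
  have dR: "d \<in> range D" using d dg_range[OF D] by simp
  have eR: "e \<in> range D" using e dg_range[OF E] inv_pair_range[OF ip] by simp
  have Ez: "D z = d + D ones" if "E z = e" for z
  proof -
    have "D e = D z + e" using inv_pairD(4)[OF ip, of z] that by simp
    then have "D z = e + D e" by (metis add.commute bvec_double(2))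
    then show ?thesis using Do by (simp add: ac_simps)
  qed
  have H: "special {v \<in> range D. dot z v = 0} \<or> D z \<in> X" if "dot d z = 1" "dot e z = 1" for z
  proof -
    have "special {v \<in> range D. dot z v = 0} \<or> r \<noteq> 3 \<and> (D z = d \<or> E z = e)"
      using neg that by blast
    then show ?thesis using Ez[of z] unfolding X_def by (auto simp del: Collect_conj_eq)
  qed
  have finW: "finite ?W" using D by (rule finite_classes)
  have cX: "card X \<le> 2" "r = 3 \<Longrightarrow> card X = 0" "finite X"
    by (auto simp: X_def card_insert_if)
  have cW: "2 ^ r \<le> 4 * card ?W"
    using card_classes_two[OF D dR eR d(2) e(2)] c by simp
  have cW': "2 ^ r = 2 * card ?W" if "d = e"
    using card_classes_one[OF D dR d(2)] c that by simp
  have big: "r = 3 \<or> (2::nat) ^ 4 \<le> 2 ^ r"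
    using r power_increasing[of 4 r "2::nat"] by linarith
  \<comment> \<open>\<open>hyperplane_special_pair\<close> applied to \<open>d\<close> and to
    \<open>e\<close>. The sum D p + D q depends only on \<open>D\<close> and \<open>d\<close>, so
    any special candidate other than \<open>D p\<close> must have the value
    \<open>D q\<close>.\<close>
  have pair: "D d + scl (dot ones d) (D ones) = D p + D q \<and> D e + scl (dot ones e) (D ones) = D p + D q"
    if p: "dot d p = 1" "dot e p = 1" "special {v \<in> range D. dot p v = 0}"
      and q: "dot d q = 1" "dot e q = 1" "special {v \<in> range D. dot q v = 0}" and ne: "D p \<noteq> D q" for p q
  proof -
    have ex: "\<exists>v\<in>range D. dot p v \<noteq> dot q v" using ne symop_eq_iff[OF D, of p q] by blast
    have "D (f + scl (dot ones f) ones) = D (p + q)" if "f \<in> range D" "dot p f = 1" "dot q f = 1" for f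
      unfolding symop_eq_iff[OF D]
      using hyperplane_special_pair[OF symop_range[OF D] nsp p(3) q(3) that ex] by simp
    from this[OF dR] this[OF eR] show ?thesis
      using p q by (simp add: dot_commute symop_add[OF D] symop_scl[OF D])
  qed
  let ?Q = "\<lambda>z. dot d z = 1 \<and> dot e z = 1 \<and> special {v \<in> range D. dot z v = 0}"
  have "\<exists>p q. ?Q p \<and> ?Q q \<and> D p \<noteq> D q"
  proof (rule ccontr)
    assume "\<not> ?thesis"
    then have all: "D z = D z'" if "?Q z" "?Q z'" for z z' using that by blast
    have "\<exists>x. ?W \<subseteq> insert x X"
    proof (cases "\<exists>z. dot d z = 1 \<and> dot e z = 1 \<and> special {v \<in> range D. dot z v = 0}")
      case True
      then obtain z where "dot d z = 1" "dot e z = 1" "special {v \<in> range D. dot z v = 0}" by blast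
      then have "?W \<subseteq> insert (D z) X" using all H by blast
      then show ?thesis by blast
    next
      case False
      then have "?W \<subseteq> X" using H by blast
      then show ?thesis by blast
    qed
    then obtain x where "?W \<subseteq> insert x X" by blast
    then have "card ?W \<le> card (insert x X)" by (intro card_mono) (simp_all add: cX)
    also have "\<dots> \<le> Suc (card X)" using card_insert_le_m1[of "Suc (card X)" X x] by simp
    finally have "card ?W \<le> Suc (card X)" .
    then show False using cW cX big by auto
  qed
  then obtain p q where p: "dot d p = 1" "dot e p = 1" "special {v \<in> range D. dot p v = 0}"
    and q: "dot d q = 1" "dot e q = 1" "special {v \<in> range D. dot q v = 0}" and ne: "D p \<noteq> D q"
    by blast
  have cover: "D z = D p \<or> D z = D q"
    if z: "dot d z = 1" "dot e z = 1" "special {v \<in> range D. dot z v = 0}" for z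
  proof (cases "D z = D p")
    case False
    have "D p + D z = D p + D q" using pair[OF p z] pair[OF p q ne] False by metis
    then show ?thesis by simp
  qed simp
  note hd = conjunct1[OF pair[OF p q ne]] and he = conjunct2[OF pair[OF p q ne]]
  have W: "?W \<subseteq> X \<union> {D p, D q}" using H cover by blast
  have "card ?W \<le> card (X \<union> {D p, D q})" by (intro card_mono W) (simp add: cX)
  also have "\<dots> \<le> card X + card {D p, D q}" by (rule card_Un_le)
  also have "\<dots> \<le> card X + 2" by (simp add: card_insert_if)
  finally have cW2: "card ?W \<le> card X + 2" .
  \<comment> \<open>Equal diagonals would impose a single condition on \<open>z\<close>, and 2^(r-1)
    admissible values exceed the bound just found.\<close>
  have de: "d \<noteq> e" using cW2 cW' cX big by auto
  have no_ones: False if "dot ones e = 0" "D ones = D p + D q"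
  proof -
    have "D ones = D e" using he that by simp
    then have "d + e = 0" using Do by (metis add_0 add_right_imp_eq)
    then show False using de bvec_eq_iff by blast
  qed
  show False
  proof (cases "r = 3")
    case True
    then have Z: "D z = D p \<or> D z = D q" if "dot d z = 1" "dot e z = 1" for z
      using W that by (auto simp: X_def)
    consider "dot ones d = 0" "dot ones e = 0" | "dot ones d = 0" "dot ones e = 1"
      | "dot ones d = 1" "dot ones e = 0"
      using no by (cases "dot ones d"; cases "dot ones e") auto
    then show False
    proof cases
      case 1
      \<comment> \<open>Here 1 is orthogonal to both diagonals, so p + 1 is again
        admissible.\<close>
      then have "D (p + ones) = D p \<or> D (p + ones) = D q"
        using p by (intro Z) (simp_all add: dot_commute[of _ ones])
      then have "D ones = D p + D q"
        using o bvec_double(2)[of "D p" "D ones"] by (auto simp: symop_add[OF D])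
      then show False using no_ones 1 by simp
    next
      case 2
      then show False
        using no_asymmetric_pair[OF ip d e p(1,2) q(1,2) ne Z hd he] by blast
    next
      case 3
      have lift: "E a + scl c (E b) = E p + E q" if "D a + scl c (D b) = D p + D q" for a b c
        using inv_pair_eq_iff[OF ip, of "a + scl c b" "p + q"] that
        by (simp add: symop_add[OF D] symop_scl[OF D] symop_add[OF E] symop_scl[OF E])
      show False
        using no_asymmetric_pair[OF inv_pair_swap[OF ip] e d p(2,1) q(2,1) _ _ lift[OF he] lift[OF hd] 3(2,1)]
          Z ne inv_pair_eq_iff[OF ip] by blast
    qed
  next
    case False
    let ?S = "{d, d + D ones, D p, D q}"
    have WS: "?W \<subseteq> ?S" using W False by (auto simp: X_def)
    have "4 \<le> card ?W" using cW big False by simp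
    moreover have "card ?S \<le> 4" by (simp add: card_insert_if)
    ultimately have eq: "?W = ?S" and cS: "card ?S = 4"
      using card_seteq[OF _ WS] card_mono[OF _ WS] by auto
    have dist: "d \<noteq> D p" "d \<noteq> D q"
      using cS by (auto simp: card_insert_if split: if_splits)
    have "d \<in> ?W" "d + D ones \<in> ?W" unfolding eq by simp_all
    then obtain z0 z1 where "d = D z0" and z0': "dot d z0 = 1" "dot e z0 = 1"
      and "d + D ones = D z1" and z1': "dot d z1 = 1" "dot e z1 = 1" by blast
    then have z0: "D z0 = d" "dot d z0 = 1" "dot e z0 = 1"
      and z1: "D z1 = d + D ones" "dot d z1 = 1" "dot e z1 = 1" by simp_all
    \<comment> \<open>Admissible values are closed under sums of three. Among the four distinct
      values, the sum of \<open>D p\<close>, \<open>D q\<close> and \<open>d\<close> must be the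
      remaining one d + D 1, so D 1 = D p + D q.\<close>
    have "D (p + q + z0) \<in> ?W" using p q z0 by fastforce
    then have "D p + D q + d \<in> ?S" unfolding eq by (simp add: symop_add[OF D] z0)
    then consider "D p + D q + d = d" | "D p + D q + d = d + D ones" | "D p + D q + d = D p"
      | "D p + D q + d = D q" by blast
    then show False
    proof cases
      case 1
      then show False using ne bvec_eq_iff[of "D p" "D q"] by simp
    next
      case 2
      then have "D ones = D p + D q" by (metis add.commute add_left_cancel)
      moreover have "dot ones e = 0"
      proof -
        have "D (z0 + z1) = D ones" by (simp add: symop_add[OF D] z0 z1)
        then have "dot (z0 + z1) e = dot ones e" using symop_eq_iff[OF D] eR by blast
        then show ?thesis using z0 z1 by (simp add: dot_commute[of _ e])
      qed
      ultimately show False using no_ones by simp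
    next
      case 3
      then show False using dist bvec_eq_iff[of d "D q"] by (simp add: add.assoc add.commute)
    next
      case 4
      then have "D p + d = 0" by (simp add: ac_simps)
      then show False using dist bvec_eq_iff[of d "D p"] by (simp add: add.commute)
    qed
  qed
qed

lemma special_card_le_two:
  assumes V: "subspace V" and c: "card V \<le> 2"
  shows "special V"
  unfolding special_def
proof (intro ballI)
  fix u v assume uv: "u \<in> V" "v \<in> V"
  have "u = 0 \<or> v = 0 \<or> u = v"
  proof (rule ccontr)
    assume "\<not> ?thesis"
    then have "card {0, u, v} = 3" by auto
    moreover have "card {0, u, v} \<le> card V" using uv subspaceD[OF V] by (intro card_mono) auto
    ultimately show False using c by simp
  qed
  moreover have "dot v v = dot ones v * dot ones v"
    by (cases "dot v v") (simp_all add: dot_ones)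
  ultimately show "dot u v = dot ones u * dot ones v" by auto
qed

text \<open>\<open>good_step\<close> preserves the hypotheses while lowering the rank. It does not
  apply if D 1 = 0, where \<open>conn_ones_kernel\<close> takes over, nor if both diagonals have odd
  weight; in that case z = 1 is admissible and creates D 1 = 0.\<close>

lemma conn_live:
  assumes "inv_pair D E" "card (range D) = 2 ^ r" "dg D \<noteq> 0" "dg E \<noteq> 0" "\<not> special (range D)"
  shows "conn r D"
  using assms
proof (induction r arbitrary: D E)
  case 0
  then show ?case using special_card_le_two[OF symop_range] inv_pairD(1) by force
next
  case (Suc r)
  note ip = Suc.prems(1)
  note D = inv_pairD(1)[OF ip] and E = inv_pairD(2)[OF ip]
  have "r \<noteq> 0"
  proof
    assume "r = 0"
    then show False
      using Suc.prems(2,5) special_card_le_two[OF symop_range[OF D]] by simp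
  qed
  have step: "conn (Suc r) D" if "dot (dg D) z = 1" "dot (dg E) z = 1" "conn r (upd D (D z))" for z
  proof -
    have "D z \<noteq> 0" using that(1) dot_dg[OF D, of z] by auto
    then show ?thesis using inv_pair_step(4)[OF ip, of z r] that by simp
  qed
  have card: "card (range (upd D (D z))) = 2 ^ r" if "dot (dg D) z = 1" for z
    using range_upd_hyperplane(2)[OF D that] Suc.prems(2) by simp
  consider "D ones = 0" | "dot ones (dg D) = 1" "dot ones (dg E) = 1" | "r = 1"
    | "D ones \<noteq> 0" "\<not> (dot ones (dg D) = 1 \<and> dot ones (dg E) = 1)" "2 \<le> r"
    using \<open>r \<noteq> 0\<close> by linarith
  then show ?case
  proof cases
    case 1
    then show ?thesis using conn_ones_kernel[OF ip Suc.prems(2)] Suc.prems(3) by simp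
  next
    case 2
    then have z: "dot (dg D) ones = 1" "dot (dg E) ones = 1" by (simp_all add: dot_commute[of _ ones])
    then have zeq: "dot (dg D) ones = dot (dg E) ones" by simp
    \<comment> \<open>By \<open>image_ones\<close> this vector is I + D applied to the nonzero
      diagonal of \<open>E\<close>.\<close>
    have "dg D + D ones \<noteq> 0"
    proof
      assume "dg D + D ones = 0"
      then have "dg E + D (dg E) = 0" using image_ones[OF ip] by (simp add: ac_simps)
      then show False using inv_pair_nonsing[OF ip] Suc.prems(4) by (auto simp: nonsing_def)
    qed
    moreover have "upd D (D ones) ones = 0"
      using dot_dg[OF D, of ones] z by (simp add: upd_def dot_commute[of "D ones"])
    ultimately have "conn r (upd D (D ones))"
      using conn_ones_kernel[OF inv_pair_step(1)[OF ip zeq] card[OF z(1)]] inv_pair_step(2)[OF ip zeq]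
      by simp
    then show ?thesis using step z by blast
  next
    case 3
    obtain z where z: "dot (dg D) z = 1" "dot (dg E) z = 1"
      using separating_vector[of "dg D" "dg E"] Suc.prems(3,4) by auto
    then have zeq: "dot (dg D) z = dot (dg E) z" by simp
    have "conn r (upd D (D z))"
      using conn_rank_one[OF inv_pair_step(1)[OF ip zeq]] card[OF z(1)] 3 by simp
    then show ?thesis using step z by blast
  next
    case 4
    obtain z where z: "dot (dg D) z = 1" "dot (dg E) z = 1"
      and nsp: "\<not> special {v \<in> range D. dot z v = 0}"
      and zr: "Suc r = 3 \<or> D z \<noteq> dg D \<and> E z \<noteq> dg E"
      using good_step[OF ip refl Suc.prems(3) refl Suc.prems(4,2) _ 4(1,2) Suc.prems(5)] 4(3) by auto
    then have zeq: "dot (dg D) z = dot (dg E) z" by simp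
    note st = inv_pair_step[OF ip zeq]
    let ?D = "upd D (D z)" and ?E = "upd E (E z)"
    have nsp': "\<not> special (range ?D)" using nsp range_upd_hyperplane(1)[OF D z(1)] by simp
    have "dg ?D \<noteq> 0 \<and> dg ?E \<noteq> 0"
    \<comment> \<open>At rank 2 the choice of \<open>z\<close> has only ensured that the hyperplane
      is not special; by \<open>special_rank_two\<close> this already keeps both diagonals
      alive.\<close>
    proof (cases "r = 2")
      case True
      then have "card (range ?D) = 4" using card[OF z(1)] by simp
      then show ?thesis
        using nsp' special_rank_two[of ?D] special_rank_two[of ?E] inv_pairD(1,2)[OF st(1)]
          inv_pair_nonsing[OF st(1)] inv_pair_nonsing[OF inv_pair_swap[OF st(1)]]
          inv_pair_range[OF st(1)] by auto
    next
      case False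
      then show ?thesis using zr bvec_eq_iff[of "dg D" "D z"] bvec_eq_iff[of "dg E" "E z"]
        unfolding st(2,3) by auto
    qed
    then have "conn r ?D" using Suc.IH[OF st(1) card[OF z(1)] _ _ nsp'] by blast
    then show ?thesis using step z by blast
  qed
qed

lemma avoid_two:
  assumes D: "symop D" and u: "u \<in> range D" and c: "8 \<le> card (range D)"
  shows "\<exists>z. dot u z = 0 \<and> D z \<noteq> x \<and> D z \<noteq> y"
proof -
  let ?W = "{D z |z. dot u z = 0}"
  obtain a where a: "u = D a" using u by auto
  have W: "?W = {w \<in> range D. dot a w = 0}" by (auto simp: a symop_adj[OF D])
  have "card (range D) \<le> 2 * card ?W"
  proof (cases "\<exists>w\<in>range D. dot a w = 1")
    case True
    then show ?thesis unfolding W using card_hyperplane[OF symop_range[OF D]] by force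
  next
    case False
    then have "{w \<in> range D. dot a w = 0} = range D" by auto
    then show ?thesis unfolding W by simp
  qed
  then have "2 < card ?W" using c by simp
  moreover have "card {x, y} \<le> 2" by (simp add: card_insert_if)
  ultimately have "\<not> ?W \<subseteq> {x, y}" using card_mono[of "{x, y}" ?W] by auto
  then show ?thesis by blast
qed

text \<open>When a diagonal vanishes, a neutral step with \<open>z\<close> orthogonal to both
  diagonals keeps the column space and moves the diagonals by \<open>D z\<close> and
  \<open>E z\<close>. This accounts for the additional step. The rank is at least 3 here, since
  smaller ranks would make the space special, and that leaves room to keep both new diagonals
  nonzero.\<close>

lemma conn_not_special:
  assumes ip: "inv_pair D E" and c: "card (range D) = 2 ^ r" and nsp: "\<not> special (range D)"
  shows "conn r D \<or> conn (Suc r) D"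
proof (cases "dg D \<noteq> 0 \<and> dg E \<noteq> 0")
  case True
  then show ?thesis using conn_live[OF ip c _ _ nsp] by simp
next
  case False
  note D = inv_pairD(1)[OF ip] and E = inv_pairD(2)[OF ip]
  have "3 \<le> r"
  proof (rule ccontr)
    assume "\<not> 3 \<le> r"
    then consider "r = 0 \<or> r = 1" | "r = 2" by linarith
    then show False
    proof cases
      case 1
      then show False using nsp special_card_le_two[OF symop_range[OF D]] c by auto
    next
      case 2
      then have "card (range D) = 4" using c by simp
      then show False
        using False nsp special_rank_two[OF D inv_pair_nonsing[OF ip]]
          special_rank_two[OF E inv_pair_nonsing[OF inv_pair_swap[OF ip]]] inv_pair_range[OF ip] by auto
    qed
  qed
  then have "(2::nat) ^ 3 \<le> 2 ^ r" by (rule power_increasing) simp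
  then have c8: "8 \<le> card (range D)" using c by simp
  have "\<exists>z. dot (dg D) z = 0 \<and> dot (dg E) z = 0 \<and> D z \<noteq> 0 \<and> dg D + D z \<noteq> 0 \<and> dg E + E z \<noteq> 0"
  proof (cases "dg D = 0")
    case True
    have "dg E \<in> range D" using dg_range[OF E] inv_pair_range[OF ip] by simp
    \<comment> \<open>The second excluded value of \<open>D z\<close> is the one that corresponds to
      E z = dg E.\<close>
    then obtain z where z: "dot (dg E) z = 0" "D z \<noteq> 0" "D z \<noteq> dg E + D (dg E)"
      using avoid_two[OF D _ c8] by blast
    have "E z \<noteq> dg E"
    proof
      assume "E z = dg E"
      then have "D (dg E) = D z + dg E" using inv_pairD(4)[OF ip, of z] by simp
      then show False using z(3) by (simp add: ac_simps)
    qed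
    then have "dg E + E z \<noteq> 0" using bvec_eq_iff by metis
    then show ?thesis using z True by auto
  next
    case dD: False
    then have dE: "dg E = 0" using False by simp
    obtain z where z: "dot (dg D) z = 0" "D z \<noteq> 0" "D z \<noteq> dg D"
      using avoid_two[OF D dg_range[OF D] c8] by blast
    have "dg D + D z \<noteq> 0" using z(3) bvec_eq_iff by metis
    moreover have "E z \<noteq> 0"
      using inv_pair_eq_iff[OF ip, of z 0] z(2) symop_zero[OF D] symop_zero[OF E] by metis
    ultimately show ?thesis using z dE by auto
  qed
  then obtain z where z: "dot (dg D) z = 0" "dot (dg E) z = 0" "D z \<noteq> 0"
    and zz: "dg D + D z \<noteq> 0" "dg E + E z \<noteq> 0" by blast
  have zeq: "dot (dg D) z = dot (dg E) z" using z by simp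
  note st = inv_pair_step[OF ip zeq]
  have "conn r (upd D (D z))"
    using conn_live[OF st(1)] zz c nsp unfolding st(2,3) range_upd_same[OF D z(1)] by blast
  then show ?thesis using st(4) z(3) by blast
qed

lemma card_kernel:
  assumes "symop D"
  shows "card (range D) * card {k \<in> F. D k = 0} = 2 ^ n"
  using card_perp[OF symop_range[OF assms]] unfolding perp_range[OF assms] .

lemma dot_ones_ones: "odd n \<Longrightarrow> dot ones ones = 1"
  by (auto simp: dot_def ones_def elim!: oddE)

text \<open>The step x leaves V and is chosen so that D 1 and x witness that the enlarged space is not
  special.\<close>
lemma conn_special:
  assumes ip: "inv_pair D E" and c: "card (range D) = 2 ^ r" and sp: "special (range D)"
    and o: "D ones \<noteq> 0" and n: "odd n"
  shows "conn (Suc (Suc r)) D"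
proof -
  note D = inv_pairD(1)[OF ip] and E = inv_pairD(2)[OF ip]
  note V = subspaceD[OF symop_range[OF D]]
  define u where "u = D ones"
  have uR: "u \<in> range D" by (simp add: u_def)
  \<comment> \<open>On a special space y.(D u) = (D y).u splits as (1.(D y))(1.u) = (y.u)(1.u), so
    \<open>u\<close> is an eigenvector. Eigenvalue 1 would contradict invertibility, which gives u.1
    = 0.\<close>
  have Du: "D u = scl (dot ones u) u"
  proof (rule F_eqI)
    fix y
    have "dot y (D u) = dot (D y) u" by (rule symop_adj[OF D])
    also have "\<dots> = dot ones (D y) * dot ones u" using sp uR unfolding special_def by blast
    also have "dot ones (D y) = dot y u"
      unfolding u_def using symop_adj[OF D, of ones y] by (simp add: dot_commute)
    finally show "dot y (D u) = dot y (scl (dot ones u) u)" by (simp add: mult.commute)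
  qed (simp_all add: symop_F[OF D] u_def)
  have ou: "dot ones u = 0"
  proof (rule ccontr)
    assume "dot ones u \<noteq> 0"
    then have "D u = u" using Du by simp
    then show False using inv_pair_nonsing[OF ip] o symop_F[OF D, of ones]
      by (auto simp: nonsing_def u_def)
  qed
  \<comment> \<open>This makes u.x = 1 and (1 + dg E).x = 0 simultaneously solvable; the second
    equation is the Sherman-Morrison condition for \<open>x\<close>. In the excluded case 1 = dg D +
    u would be some \<open>D y\<close>, and u.y would be 1.1 = 1, as \<open>n\<close> is odd, but
    also 0 by the quadratic form at \<open>y\<close>.\<close>
  have neq: "u + (ones + dg E) \<noteq> 0"
  proof
    assume "u + (ones + dg E) = 0"
    then have e: "dg E = u + ones" by (metis add.commute add.left_commute bvec_double(2) add.right_neutral)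
    have "D (dg E) = u"
      using Du ou by (simp add: e symop_add[OF D] u_def)
    have "u = dg D + (u + ones) + u"
      using image_ones[OF ip, folded u_def] unfolding \<open>D (dg E) = u\<close> unfolding e .
    then have "u = dg D + ones" by (simp add: ac_simps)
    then have dD: "dg D = u + ones" by (metis add.commute bvec_double(2))
    then have "ones = dg D + u" by (simp add: ac_simps)
    then have "ones \<in> range D" using V(3)[OF dg_range[OF D] uR] by simp
    then obtain y where y: "ones = D y" by auto
    have "dot u y = 1"
      using symop_adj[OF D, of ones y] y dot_ones_ones[OF n] by (simp add: u_def)
    moreover have "dot (dg D) y = dot ones y" using dot_dg[OF D, of y] y by (simp add: dot_commute)
    ultimately show False by (simp add: dD)
  qed
  obtain x' where x': "dot u x' = 1" "dot (u + (ones + dg E)) x' = 1"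
    using separating_vector[of u "u + (ones + dg E)"] neq o symop_F[OF D] by (auto simp: u_def)
  \<comment> \<open>\<open>separating_vector\<close> does not place its witness in \<open>F\<close>;
    truncation changes none of the products.\<close>
  define x where "x = (\<lambda>i. if i < n then x' i else 0)"
  have xF: "x \<in> F" by (simp add: x_def F_def)
  have loc: "dot v x = dot v x'" for v
    unfolding dot_commute[of v] by (rule dot_local) (simp add: x_def)
  have x: "dot u x = 1" "dot (ones + dg E) x = 0" using x' by (simp_all add: loc)
  define w where "w = x + E x"
  have xw: "dot x w = 0"
    using x(2) dot_dg[OF E, of x] by (simp add: w_def dot_ones[symmetric])
  have xV: "x \<notin> range D"
  proof
    assume "x \<in> range D"
    then have "dot u x = dot ones u * dot ones x" using sp uR unfolding special_def by blast
    then show False using x ou by simp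
  qed
  let ?D = "upd D x" and ?E = "upd E w"
  have ip': "inv_pair ?D ?E" by (rule inv_pair_upd[OF ip xF w_def xw])
  note D' = inv_pairD(1)[OF ip']
  have ker: "?D y = 0 \<longleftrightarrow> D y = 0 \<and> dot x y = 0" for y
  proof (cases "dot x y = 1")
    case True
    have "D y \<noteq> x" using xV by auto
    then have "D y + x \<noteq> 0" using bvec_eq_iff by metis
    then show ?thesis using True by (simp add: upd_def)
  qed (simp add: upd_def)
  let ?K = "{k \<in> F. D k = 0}"
  have K: "subspace ?K" using subspace_perp[of "range D"] perp_range[OF D] by simp
  have K': "{k \<in> F. ?D k = 0} = {k \<in> ?K. dot x k = 0}" by (auto simp: ker)
  have "range D \<subseteq> range ?D"
    unfolding symop_range_eq[OF D] symop_range_eq[OF D'] K' by (auto simp: perp_def)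
  then have uR': "u \<in> range ?D" using uR by blast
  have xR': "x \<in> range ?D"
    unfolding symop_range_eq[OF D'] K' using xF by (auto simp: perp_def)
  have nsp: "\<not> special (range ?D)"
  proof
    assume "special (range ?D)"
    then have "dot u x = dot ones u * dot ones x" using uR' xR' unfolding special_def by blast
    then show False using x ou by simp
  qed
  have "\<exists>k\<in>?K. dot x k = 1"
    using xV xF unfolding symop_range_eq[OF D] by (auto simp: perp_def)
  then have "card ?K = 2 * card {k \<in> F. ?D k = 0}"
    unfolding K' using card_hyperplane[OF K] by blast
  then have "2 * card (range D) * card {k \<in> F. ?D k = 0} = card (range ?D) * card {k \<in> F. ?D k = 0}"
    using card_kernel[OF D] card_kernel[OF D'] by (simp add: ac_simps)
  moreover have "card {k \<in> F. ?D k = 0} \<noteq> 0"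
  proof
    assume "card {k \<in> F. ?D k = 0} = 0"
    then show False using card_kernel[OF D'] by (metis mult_zero_right power_not_zero zero_neq_numeral)
  qed
  ultimately have c': "card (range ?D) = 2 ^ Suc r" using c by simp
  \<comment> \<open>The old diagonals lie in V, whereas the squares added to \<open>D\<close> and
    \<open>E\<close> belong to \<open>x\<close> and \<open>w\<close>, which do not.\<close>
  have "dg ?D \<noteq> 0"
  proof
    assume "dg ?D = 0"
    then have "dg D = x" using dg_upd[OF D xF] bvec_eq_iff[of "dg D" x] by simp
    then show False using xV dg_range[OF D] by simp
  qed
  moreover have "dg ?E \<noteq> 0"
  proof
    have wF: "w \<in> F" using xF symop_F[OF E] by (simp add: w_def)
    assume "dg ?E = 0"
    then have "dg E = w" using dg_upd[OF E wF] bvec_eq_iff[of "dg E" w] by simp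
    then have "w \<in> range D" using dg_range[OF E] inv_pair_range[OF ip] by simp
    moreover have "E x \<in> range D" using inv_pair_range[OF ip] by auto
    ultimately have "w + E x \<in> range D" using V(3) by blast
    then show False using xV by (simp add: w_def add.assoc)
  qed
  ultimately have "conn (Suc r) ?D" using conn_live[OF ip' c' _ _ nsp] by blast
  moreover have "x \<noteq> 0" using x by auto
  ultimately show ?thesis using conn_Suc D inv_pair_nonsing[OF ip] xF by blast
qed

end


section \<open>Sums of squares and lower bounds\<close>

text \<open>Lists rather than sets, because a path may use the same vector repeatedly and its order
  matters.\<close>

primrec lspan :: "bvec list \<Rightarrow> bvec set" where
  "lspan [] = {0}"
| "lspan (x # xs) = lspan xs \<union> (+) x ` lspan xs"

primrec lindep :: "bvec list \<Rightarrow> bool" where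
  "lindep [] = True"
| "lindep (x # xs) \<longleftrightarrow> x \<notin> lspan xs \<and> lindep xs"

text \<open>Coefficients are functions of the vector and not of its position, like the products with
  a fixed vector in \<open>opl_comb\<close>.\<close>

primrec comb :: "(bvec \<Rightarrow> bit) \<Rightarrow> bvec list \<Rightarrow> bvec" where
  "comb c [] = 0"
| "comb c (x # xs) = scl (c x) x + comb c xs"

lemma lspan_zero: "0 \<in> lspan xs"
  by (induction xs) auto

lemma lspan_set: "x \<in> set xs \<Longrightarrow> x \<in> lspan xs"
  by (induction xs) (auto intro: image_eqI[of _ _ 0] simp: lspan_zero)

lemma lspan_add: "u \<in> lspan xs \<Longrightarrow> v \<in> lspan xs \<Longrightarrow> u + v \<in> lspan xs"
proof (induction xs arbitrary: u v)
  case (Cons x xs)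
  from Cons.prems obtain a b where "a \<in> lspan xs" "u = a \<or> u = x + a" "b \<in> lspan xs" "v = b \<or> v = x + b"
    by auto
  moreover from this have "a + b \<in> lspan xs" using Cons.IH by blast
  moreover have "a + (x + b) = x + (a + b)" "x + a + b = x + (a + b)" "x + a + (x + b) = a + b"
    by (simp_all add: ac_simps)
  ultimately show ?case by (elim disjE) (auto simp del: add.assoc)
qed simp

lemma lspan_scl: "v \<in> lspan xs \<Longrightarrow> scl c v \<in> lspan xs"
  by (cases c) (simp_all add: lspan_zero)

lemma finite_lspan [simp]: "finite (lspan xs)"
  by (induction xs) auto

lemma card_lspan_le: "card (lspan xs) \<le> 2 ^ length xs"
proof (induction xs)
  case (Cons x xs)
  have "card (lspan (x # xs)) \<le> card (lspan xs) + card ((+) x ` lspan xs)"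
    by (simp add: card_Un_le)
  also have "card ((+) x ` lspan xs) \<le> card (lspan xs)" by (rule card_image_le) simp
  finally show ?case using Cons by simp
qed simp

lemma card_lspan: "lindep xs \<Longrightarrow> card (lspan xs) = 2 ^ length xs"
proof (induction xs)
  case (Cons x xs)
  have "lspan xs \<inter> (+) x ` lspan xs = {}"
  proof (rule ccontr)
    assume "lspan xs \<inter> (+) x ` lspan xs \<noteq> {}"
    then obtain a where a: "a \<in> lspan xs" "x + a \<in> lspan xs" by auto
    then have "x + a + a \<in> lspan xs" by (metis lspan_add)
    then show False using Cons.prems by (simp add: add.assoc)
  qed
  then have "card (lspan (x # xs)) = card (lspan xs) + card ((+) x ` lspan xs)"
    by (simp add: card_Un_disjoint)
  also have "card ((+) x ` lspan xs) = card (lspan xs)" by (rule card_image) (simp add: inj_on_def)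
  finally show ?case using Cons by simp
qed simp

lemma comb_lspan: "comb c xs \<in> lspan xs"
proof (induction xs)
  case (Cons x xs)
  then show ?case by (cases "c x") auto
qed simp

lemma comb_add: "comb c xs + comb d xs = comb (\<lambda>x. c x + d x) xs"
proof (induction xs)
  case (Cons x xs)
  have "comb c (x # xs) + comb d (x # xs) = (scl (c x) x + scl (d x) x) + (comb c xs + comb d xs)"
    by (simp add: ac_simps)
  then show ?case by (simp add: Cons scl_add)
qed simp

lemma scl_comb: "scl b (comb c xs) = comb (\<lambda>x. b * c x) xs"
proof (cases b)
  show "b = 0 \<Longrightarrow> ?thesis" by (simp, induction xs) auto
qed simp

lemma comb_cong: "(\<And>x. x \<in> set xs \<Longrightarrow> c x = d x) \<Longrightarrow> comb c xs = comb d xs"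
  by (induction xs) auto

lemma comb_zero: "comb (\<lambda>x. 0) xs = 0"
  by (induction xs) auto

lemma lindep_comb: "lindep xs \<Longrightarrow> comb c xs = 0 \<Longrightarrow> x \<in> set xs \<Longrightarrow> c x = 0"
proof (induction xs)
  case (Cons y ys)
  have "c y = 0"
  proof (rule ccontr)
    assume "c y \<noteq> 0"
    then have "y + comb c ys = 0" using Cons.prems by simp
    then have "y = comb c ys" using bvec_eq_iff by blast
    then show False using Cons.prems comb_lspan[of c ys] by simp
  qed
  then show ?case using Cons by auto
qed simp

lemma comb_middle: "comb c (ys @ x # zs) = scl (c x) x + comb c (ys @ zs)"
  by (induction ys) (simp_all add: ac_simps)

lemma lspan_map:
  assumes "\<And>x y. f (x + y) = f x + f y"
  shows "lspan (map f xs) = f ` lspan xs"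
proof -
  have "f 0 = 0" using assms[of 0 0] by simp
  then show ?thesis
    by (induction xs) (simp_all add: image_Un image_image assms)
qed

lemma lindep_map:
  assumes "\<And>x y. f (x + y) = f x + f y" "inj_on f (lspan xs)"
  shows "lindep (map f xs) \<longleftrightarrow> lindep xs"
  using assms(2)
proof (induction xs)
  case (Cons x xs)
  have "inj_on f (lspan xs)" using Cons.prems by (rule inj_on_subset) auto
  moreover have "f x \<in> f ` lspan xs \<longleftrightarrow> x \<in> lspan xs"
    using Cons.prems lspan_set[of x "x # xs"] by (intro inj_on_image_mem_iff) auto
  ultimately show ?case using Cons.IH by (simp add: lspan_map[OF assms(1)])
qed simp

lemma lindep_distinct: "lindep xs \<Longrightarrow> distinct xs"
  by (induction xs) (auto dest: lspan_set)

context binary_space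
begin

lemma lspan_subset: "subspace V \<Longrightarrow> set xs \<subseteq> V \<Longrightarrow> lspan xs \<subseteq> V"
  by (induction xs) (auto dest: subspaceD)

lemma subspace_lspan: "set xs \<subseteq> F \<Longrightarrow> subspace (lspan xs)"
  using lspan_subset[OF subspace_F] lspan_zero lspan_add by (auto simp: subspace_def)

primrec opl :: "bvec list \<Rightarrow> bvec \<Rightarrow> bvec" where
  "opl [] = (\<lambda>_. 0)"
| "opl (x # xs) = upd (opl xs) x"

lemma opl_comb: "opl xs y = comb (\<lambda>x. dot x y) xs"
  by (induction xs) (simp_all add: upd_def add.commute)

lemma symop_opl: "set xs \<subseteq> F \<Longrightarrow> symop (opl xs)"
  by (induction xs) (auto simp: symop_upd, auto simp: symop_def)

lemma dot_comb: "dot (comb c xs) y = (\<Sum>x\<leftarrow>xs. c x * dot x y)"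
  by (induction xs) simp_all

lemma dg_opl: "set xs \<subseteq> F \<Longrightarrow> dg (opl xs) = comb (\<lambda>_. 1) xs"
proof (induction xs)
  case Nil
  show ?case by (rule ext) (simp add: dg_def zero_fun_apply)
next
  case (Cons x xs)
  then show ?case by (simp add: dg_upd symop_opl add.commute)
qed

lemma range_eqI:
  assumes D: "symop D" and V: "subspace V" and k: "\<And>k. D k = 0 \<longleftrightarrow> (\<forall>v\<in>V. dot k v = 0)"
  shows "range D = V"
proof -
  have "{k \<in> F. D k = 0} = perp V" using k by (auto simp: perp_def)
  then show ?thesis using symop_range_eq[OF D] perp_perp[OF V] by simp
qed

lemma perp_lspan: "(\<forall>v\<in>lspan xs. dot k v = 0) \<longleftrightarrow> (\<forall>x\<in>set xs. dot x k = 0)"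
proof (induction xs)
  case (Cons x xs)
  have "(\<forall>v\<in>lspan (x # xs). dot k v = 0) \<longleftrightarrow> (\<forall>v\<in>lspan xs. dot k v = 0 \<and> dot k x + dot k v = 0)"
    by (auto simp: ball_Un)
  also have "\<dots> \<longleftrightarrow> dot k x = 0 \<and> (\<forall>v\<in>lspan xs. dot k v = 0)"
    using lspan_zero[of xs] by (metis add.right_neutral dot_zero(2))
  finally show ?case using Cons by (simp add: dot_commute)
qed simp

text \<open>Independence forces every coefficient x.k of a kernel vector \<open>k\<close> to vanish,
  so the kernel consists of the vectors orthogonal to the span.\<close>

lemma range_opl:
  assumes F: "set xs \<subseteq> F" and i: "lindep xs"
  shows "range (opl xs) = lspan xs"
proof (rule range_eqI)
  show "symop (opl xs)" "subspace (lspan xs)" using F symop_opl subspace_lspan by auto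
  fix k
  have "comb (\<lambda>x. dot x k) xs = 0" if "\<forall>x\<in>set xs. dot x k = 0"
    using comb_cong[of xs "\<lambda>x. dot x k" "\<lambda>x. 0"] comb_zero that by simp
  moreover have "\<forall>x\<in>set xs. dot x k = 0" if "comb (\<lambda>x. dot x k) xs = 0"
    using lindep_comb[OF i that] by blast
  ultimately show "opl xs k = 0 \<longleftrightarrow> (\<forall>v\<in>lspan xs. dot k v = 0)"
    unfolding perp_lspan opl_comb by blast
qed

lemma sum_list_const_bit: "(\<And>x. x \<in> set xs \<Longrightarrow> f x = (b::bit)) \<Longrightarrow> sum_list (map f xs) = (if even (length xs) then 0 else b)"
  by (induction xs) auto

text \<open>For a kernel vector \<open>k\<close>, independence gives x.k = s.k for all
  \<open>x\<close> in the list, with s their total. Summing an even number of equal terms gives s.k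
  = 0, so every product vanishes.\<close>

lemma range_opl_sum:
  assumes F: "set xs \<subseteq> F" and i: "lindep xs" and e: "even (length xs)"
  shows "range (upd (opl xs) (comb (\<lambda>_. 1) xs)) = lspan xs"
proof (rule range_eqI)
  let ?s = "comb (\<lambda>_. 1) xs"
  have sF: "?s \<in> F" using comb_lspan subspaceD(1)[OF subspace_lspan[OF F]] by blast
  show "symop (upd (opl xs) ?s)" "subspace (lspan xs)"
    using symop_upd[OF symop_opl[OF F] sF] subspace_lspan[OF F] by auto
  fix k
  have D: "upd (opl xs) ?s k = comb (\<lambda>x. dot x k + dot ?s k) xs"
    by (simp add: upd_def opl_comb scl_comb comb_add)
  have dots: "dot ?s k = 0" if "\<And>x. x \<in> set xs \<Longrightarrow> dot x k = b" for b
    using sum_list_const_bit[of xs "\<lambda>x. dot x k" b] that e by (simp add: dot_comb)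
  show "upd (opl xs) ?s k = 0 \<longleftrightarrow> (\<forall>v\<in>lspan xs. dot k v = 0)"
    unfolding perp_lspan
  proof
    assume "upd (opl xs) ?s k = 0"
    then have *: "dot x k = dot ?s k" if "x \<in> set xs" for x
      using lindep_comb[OF i, of "\<lambda>x. dot x k + dot ?s k"] that unfolding D by (simp add: bit_sum_eq_iff)
    from dots[OF this] have "dot ?s k = 0" .
    then show "\<forall>x\<in>set xs. dot x k = 0" using * by simp
  next
    assume *: "\<forall>x\<in>set xs. dot x k = 0"
    then have "comb (\<lambda>x. dot x k + dot ?s k) xs = comb (\<lambda>x. 0) xs"
      using dots[of 0] by (intro comb_cong) auto
    also have "\<dots> = 0" by (rule comb_zero)
    finally show "upd (opl xs) ?s k = 0" unfolding D .
  qed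
qed

text \<open>On a special \<open>V\<close> the operator is y |-> (1.y) s, where s is the sum of the
  odd-weight members of the list. A fixed vector lies in \<open>V\<close> and can only be 0 or s,
  and s is fixed and nonzero exactly when 1.s = 1; moreover 1.s counts the odd-weight members modulo
  2.\<close>

lemma nonsing_opl_iff:
  assumes V: "subspace V" and sp: "special V" and xs: "set xs \<subseteq> V"
  shows "nonsing (opl xs) \<longleftrightarrow> (\<Sum>x\<leftarrow>xs. dot ones x) = 0"
proof -
  let ?s = "comb (dot ones) xs"
  have sV: "?s \<in> V" using comb_lspan lspan_subset[OF V xs] by blast
  have act: "opl xs y = scl (dot ones y) ?s" if "y \<in> V" for y
    unfolding opl_comb scl_comb
    using sp xs that by (intro comb_cong) (auto simp: special_def mult.commute)
  have "dot ones ?s = (\<Sum>x\<leftarrow>xs. dot ones x * dot ones x)"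
    using dot_comb[of "dot ones" xs ones] by (simp add: dot_commute)
  also have "(\<lambda>x. dot ones x * dot ones x) = dot ones"
  proof
    fix x show "dot ones x * dot ones x = dot ones x" by (cases "dot ones x") auto
  qed
  finally have os: "dot ones ?s = (\<Sum>x\<leftarrow>xs. dot ones x)" .
  show ?thesis
  proof
    assume ns: "nonsing (opl xs)"
    show "(\<Sum>x\<leftarrow>xs. dot ones x) = 0"
    proof (rule ccontr)
      assume "(\<Sum>x\<leftarrow>xs. dot ones x) \<noteq> 0"
      then have o1: "dot ones ?s = 1" using os by simp
      then have "?s + opl xs ?s = 0" using act[OF sV] by simp
      then have "?s = 0" using ns sV subspaceD(1)[OF V] by (auto simp: nonsing_def)
      then show False using o1 by simp
    qed
  next
    assume o0: "(\<Sum>x\<leftarrow>xs. dot ones x) = 0"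
    show "nonsing (opl xs)"
      unfolding nonsing_def
    proof (intro ballI impI)
      fix y assume "y + opl xs y = 0"
      then have y: "y = opl xs y" using bvec_eq_iff by blast
      have "y \<in> V"
        by (subst y, unfold opl_comb) (use comb_lspan lspan_subset[OF V xs] in blast)
      then have y': "y = scl (dot ones y) ?s" using act y by simp
      then have "dot ones y = dot ones y * dot ones ?s" by (metis dot_scl(1))
      then have "dot ones y = 0" using os o0 by simp
      then show "y = 0" using y' by simp
    qed
  qed
qed

text \<open>Diagonalisation of a non-alternating form: peel off the square of \<open>D z\<close>
  with z.(D z) = 1. From rank 2 on there are at least two such values, so one different from
  \<open>dg D\<close> exists, and the remainder is again non-alternating.\<close>

lemma diagonal_basis:
  assumes "symop D" "card (range D) = 2 ^ r" "dg D \<noteq> 0 \<or> r = 0"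
  shows "\<exists>xs. D = opl xs \<and> lindep xs \<and> lspan xs = range D \<and> set xs \<subseteq> F"
  using assms
proof (induction r arbitrary: D)
  case 0
  then have "D = (\<lambda>_. 0)" using symop_card_one by auto
  then show ?case by (intro exI[of _ "[]"]) auto
next
  case (Suc r)
  note D = Suc.prems(1)
  have dg: "dg D \<noteq> 0" using Suc.prems(3) by simp
  have "\<exists>z. dot (dg D) z = 1 \<and> (r = 0 \<or> D z \<noteq> dg D)"
  proof (cases "r = 0")
    case True
    then show ?thesis using separating_vector[of "dg D" "dg D"] dg by auto
  next
    case False
    let ?W = "{D z |z. dot (dg D) z = 1}"
    have "card ?W = 2 ^ r" using card_classes_one[OF D dg_range[OF D] dg] Suc.prems(2) by simp
    moreover have "(2::nat) ^ 1 \<le> 2 ^ r" using False by (intro power_increasing) auto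
    ultimately have "1 < card ?W" by simp
    then have "\<not> ?W \<subseteq> {dg D}" using card_mono[of "{dg D}" ?W] by auto
    then show ?thesis by blast
  qed
  then obtain z where z: "dot (dg D) z = 1" "r = 0 \<or> D z \<noteq> dg D" by blast
  let ?D = "upd D (D z)"
  have DzF: "D z \<in> F" by (rule symop_F[OF D])
  have zz: "dot z (D z) = 1" using z dot_dg[OF D] by simp
  have R: "range ?D = {v \<in> range D. dot z v = 0}" by (rule range_upd_hyperplane(1)[OF D z(1)])
  have "card (range ?D) = 2 ^ r" using range_upd_hyperplane(2)[OF D z(1)] Suc.prems(2) by simp
  moreover have "dg ?D \<noteq> 0 \<or> r = 0"
    using z(2) bvec_eq_iff[of "dg D" "D z"] unfolding dg_upd[OF D DzF] by auto
  ultimately obtain xs where xs: "?D = opl xs" "lindep xs" "lspan xs = range ?D" "set xs \<subseteq> F"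
    using Suc.IH[OF symop_upd[OF D DzF]] by blast
  have "D = opl (D z # xs)" using xs(1) upd_upd[of D "D z"] by simp
  moreover have "lindep (D z # xs)" using xs(2,3) R zz by simp
  moreover have "lspan (D z # xs) = range D"
  proof
    show "lspan (D z # xs) \<subseteq> range D"
      using subspaceD(3)[OF symop_range[OF D]] by (auto simp: xs(3) R)
    show "range D \<subseteq> lspan (D z # xs)"
    proof
      fix v assume v: "v \<in> range D"
      show "v \<in> lspan (D z # xs)"
      proof (cases "dot z v = 0")
        case True
        then show ?thesis using v by (simp add: xs(3) R)
      next
        case False
        then have "D z + v \<in> {v \<in> range D. dot z v = 0}"
          using v zz subspaceD(3)[OF symop_range[OF D]] by auto
        then have "D z + (D z + v) \<in> (+) (D z) ` lspan xs" unfolding xs(3) R by blast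
        then show ?thesis by simp
      qed
    qed
  qed
  ultimately show ?case using xs(4) DzF by (intro exI[of _ "D z # xs"]) auto
qed

text \<open>One neutral square \<open>D z\<close> makes the form non-alternating on the same column
  space. The diagonal \<open>D z\<close> of the new form is the total of its basis, so
  \<open>D\<close> is the sum of the basis squares plus the square of the total, which is the shape
  of \<open>A2\<close>.\<close>

lemma alternating_basis:
  assumes D: "symop D" and c: "card (range D) = 2 ^ r" "0 < r" and dg: "dg D = 0"
  shows "\<exists>xs. D = upd (opl xs) (comb (\<lambda>_. 1) xs) \<and> lindep xs \<and> lspan xs = range D \<and> set xs \<subseteq> F
    \<and> even (length xs)"
proof -
  have "\<exists>z. D z \<noteq> 0"
  proof (rule ccontr)
    assume "\<not> ?thesis"
    then have "range D = {0}" by auto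
    then have "(2::nat) ^ r = 1" using c(1) by (metis card_1_singleton_iff One_nat_def)
    then show False using c(2) by simp
  qed
  then obtain z where z: "D z \<noteq> 0" by blast
  let ?D = "upd D (D z)"
  have DzF: "D z \<in> F" by (rule symop_F[OF D])
  have D': "symop ?D" by (rule symop_upd[OF D DzF])
  have R: "range ?D = range D" by (rule range_upd_same[OF D]) (simp add: dg)
  have dg': "dg ?D = D z" using dg_upd[OF D DzF] dg by simp
  obtain xs where xs: "?D = opl xs" "lindep xs" "lspan xs = range ?D" "set xs \<subseteq> F"
    using diagonal_basis[OF D', of r] c R dg' z by auto
  have s: "D z = comb (\<lambda>_. 1) xs" using dg' dg_opl[OF xs(4)] xs(1) by simp
  have "D = upd (opl xs) (D z)" using upd_upd[of D "D z"] xs(1) by simp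
  then have D_eq: "D = upd (opl xs) (comb (\<lambda>_. 1) xs)" using s by simp
  \<comment> \<open>If the length were odd, a preimage \<open>w\<close> of \<open>D z\<close> under
    the updated operator would have product 1 with each basis vector, hence with their total
    \<open>D z\<close>. Then D w = 0, against z.(D w) = (D z).w = 1.\<close>
  have "even (length xs)"
  proof (rule ccontr)
    assume odd: "odd (length xs)"
    have "D z \<in> range ?D" unfolding R by simp
    then obtain w where w: "D z = ?D w" by auto
    have "comb (\<lambda>x. dot x w + 1) xs = 0"
      using w s unfolding xs(1) opl_comb comb_add[symmetric] by simp
    then have one: "dot x w = 1" if "x \<in> set xs" for x
      using lindep_comb[OF xs(2), of "\<lambda>x. dot x w + 1"] that by (simp add: bit_sum_eq_iff)
    have "dot (D z) w = 1"
      using sum_list_const_bit[of xs "\<lambda>x. dot x w" 1] one odd by (simp add: s dot_comb)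
    moreover have "D w + scl (dot (D z) w) (D z) = D z" using w by (simp add: upd_def)
    ultimately have "D w = 0" by simp
    then have "dot z (D w) = 0" by simp
    then show False using \<open>dot (D z) w = 1\<close> symop_adj[OF D, of z w] by simp
  qed
  then show ?thesis using D_eq xs R by blast
qed

text \<open>The head is the step taken at I + D, so the suffixes are the matrices met on the way to
  I.\<close>

primrec nonsing_chain :: "bvec list \<Rightarrow> bool" where
  "nonsing_chain [] = True"
| "nonsing_chain (x # xs) \<longleftrightarrow> nonsing (opl (x # xs)) \<and> nonsing_chain xs"

lemma conn_imp_chain:
  "conn k D \<Longrightarrow> \<exists>xs. length xs = k \<and> set xs \<subseteq> F \<and> D = opl xs \<and> nonsing_chain xs"
proof (induction rule: conn.induct)
  case conn_zero
  show ?case by (intro exI[of _ "[]"]) auto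
next
  case (conn_Suc k D x)
  then obtain xs where xs: "length xs = k" "set xs \<subseteq> F" "upd D x = opl xs" "nonsing_chain xs" by blast
  have "D = opl (x # xs)" using upd_upd[of D x] xs(3) by simp
  then show ?case using xs conn_Suc.hyps by (intro exI[of _ "x # xs"]) auto
qed

text \<open>For \<open>x\<close> outside the range, a kernel vector with product 1 with
  \<open>x\<close> expresses \<open>x\<close> through the other entries. Their span, of dimension at
  most \<open>r\<close>, contains the range, hence equals it, and so contains \<open>x\<close> after
  all.\<close>

lemma short_list_in_range:
  assumes F: "set xs \<subseteq> F" and l: "length xs \<le> Suc r" and c: "card (range (opl xs)) = 2 ^ r"
  shows "set xs \<subseteq> range (opl xs)"
proof
  note D = symop_opl[OF F]
  fix x assume x: "x \<in> set xs"
  show "x \<in> range (opl xs)"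
  proof (rule ccontr)
    assume nx: "x \<notin> range (opl xs)"
    then obtain z where z: "opl xs z = 0" "dot x z = 1"
      using x F unfolding symop_range_eq[OF D] by (auto simp: perp_def)
    obtain ys zs where s: "xs = ys @ x # zs" using split_list[OF x] by blast
    have "x + comb (\<lambda>x. dot x z) (ys @ zs) = 0"
      using z unfolding opl_comb s comb_middle by simp
    then have xin: "x \<in> lspan (ys @ zs)" using comb_lspan bvec_eq_iff by metis
    have sub: "range (opl xs) \<subseteq> lspan (ys @ zs)"
    proof
      fix v assume "v \<in> range (opl xs)"
      then obtain y where "v = opl xs y" by auto
      then have "v = scl (dot x y) x + comb (\<lambda>x. dot x y) (ys @ zs)"
        unfolding opl_comb s comb_middle by simp
      then show "v \<in> lspan (ys @ zs)" using lspan_add lspan_scl[OF xin] comb_lspan by metis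
    qed
    have "card (lspan (ys @ zs)) \<le> 2 ^ r"
      using card_lspan_le[of "ys @ zs"] power_increasing[of "length (ys @ zs)" r "2::nat"] l s
      by (simp del: power_increasing_iff)
    then have "range (opl xs) = lspan (ys @ zs)" using card_seteq[OF _ sub] c by simp
    then show False using nx xin by simp
  qed
qed

text \<open>A shorter path stays inside the special space, where \<open>nonsing_opl_iff\<close> for
  successive suffixes forces every entry to have even weight. Each coefficient x.1 of D 1 is then
  0.\<close>

lemma conn_special_lower:
  assumes k: "conn k D" and c: "card (range D) = 2 ^ r" and sp: "special (range D)" and o: "D ones \<noteq> 0"
  shows "Suc (Suc r) \<le> k"
proof (rule ccontr)
  assume "\<not> Suc (Suc r) \<le> k"
  then have kr: "k \<le> Suc r" by simp
  obtain xs where xs: "length xs = k" "set xs \<subseteq> F" "D = opl xs" "nonsing_chain xs"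
    using conn_imp_chain[OF k] by blast
  have D: "symop D" using symop_opl xs by simp
  have sub: "set xs \<subseteq> range D" using short_list_in_range[OF xs(2), of r] xs kr c by simp
  have "\<forall>x\<in>set ys. dot ones x = 0" if "set ys \<subseteq> range D" "nonsing_chain ys" for ys
    using that
  proof (induction ys)
    case (Cons y ys)
    then have z: "\<forall>x\<in>set ys. dot ones x = 0" by simp
    have "(\<Sum>x\<leftarrow>y # ys. dot ones x) = 0"
      using nonsing_opl_iff[OF symop_range[OF D] sp] Cons.prems nonsing_chain.simps(2) by blast
    moreover have "(\<Sum>x\<leftarrow>ys. dot ones x) = 0"
      using sum_list_const_bit[of ys "dot ones" 0] z by simp
    ultimately show ?case using z by simp
  qed simp
  then have all: "dot x ones = 0" if "x \<in> set xs" for x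
    using that sub xs(4) by (simp add: dot_commute)
  have "D ones = comb (\<lambda>x. 0) xs"
    unfolding xs(3) opl_comb using all by (intro comb_cong) simp
  also have "\<dots> = 0" by (rule comb_zero)
  finally show False using o by simp
qed

end


section \<open>Matrices as operators\<close>

abbreviation vspan :: "nat \<Rightarrow> bit vec set \<Rightarrow> bit vec set" where
  "vspan k \<equiv> LinearCombinations.module.span class_ring (module_vec TYPE(bit) k)"

abbreviation vindep :: "nat \<Rightarrow> bit vec set \<Rightarrow> bool" where
  "vindep k \<equiv> LinearCombinations.module.lin_indpt class_ring (module_vec TYPE(bit) k)"

context binary_space
begin

text \<open>Applied to vectors of length n and of length n + 1 alike; on the latter it deletes the
  last entry.\<close>

definition tr :: "bit vec \<Rightarrow> bvec" where
  "tr v = (\<lambda>i. if i < n then v $ i else 0)"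

lemma tr_F [simp]: "tr v \<in> F"
  by (simp add: tr_def F_def)

lemma tr_add: "n \<le> dim_vec y \<Longrightarrow> tr (x + y) = tr x + tr y"
  by (auto simp: tr_def fun_eq_iff plus_fun_apply)

lemma tr_vec: "x \<in> F \<Longrightarrow> tr (vec n x) = x"
  by (auto simp: tr_def F_def fun_eq_iff)

lemma inj_tr: "inj_on tr (carrier_vec n)"
proof (rule inj_onI)
  fix x y assume xy: "x \<in> carrier_vec n" "y \<in> carrier_vec n" "tr x = tr y"
  show "x = y"
  proof (rule eq_vecI)
    fix i assume "i < dim_vec y"
    then show "x $ i = y $ i" using xy(2) fun_cong[OF xy(3), of i] by (simp add: tr_def)
  qed (use xy in auto)
qed

lemma tr_image: "tr ` carrier_vec n = F"
proof
  show "F \<subseteq> tr ` carrier_vec n" using tr_vec by (metis image_iff subsetI vec_carrier)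
qed auto

lemma tr_zero: "tr (0\<^sub>v n) = 0"
  by (auto simp: tr_def fun_eq_iff zero_fun_apply)

lemma tr_eq_zero_iff: "v \<in> carrier_vec n \<Longrightarrow> tr v = 0 \<longleftrightarrow> v = 0\<^sub>v n"
  using inj_onD[OF inj_tr, of v "0\<^sub>v n"] tr_zero by auto

lemma bit_smult_vec: "v \<in> carrier_vec n \<Longrightarrow> (c::bit) \<cdot>\<^sub>v v = (if c = 1 then v else 0\<^sub>v n)"
  by (cases c) auto

text \<open>The vectors with truncation in \<open>lspan\<close> form a submodule, which gives one
  direction. Conversely, elements of \<open>lspan\<close> are lifted along the recursion, and
  \<open>tr\<close> is injective on vectors of length \<open>n\<close>.\<close>

lemma span_iff_lspan:
  assumes vs: "set vs \<subseteq> carrier_vec n" and v: "v \<in> carrier_vec n"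
  shows "v \<in> vspan n (set vs) \<longleftrightarrow> tr v \<in> lspan (map tr vs)"
proof -
  interpret vec_space "TYPE(bit)" n .
  let ?W = "{w \<in> carrier_vec n. tr w \<in> lspan (map tr vs)}"
  have sm: "submodule class_ring ?W (module_vec TYPE(bit) n)"
    by unfold_locales
      (auto simp: tr_zero lspan_zero tr_add lspan_add bit_smult_vec module_vec_simps)
  have "set vs \<subseteq> ?W" using vs by (auto intro: lspan_set)
  then have sub: "span (set vs) \<subseteq> ?W" using sm by (rule span_is_subset)
  have lift: "\<exists>w\<in>span (set us). tr w = x" if "x \<in> lspan (map tr us)" "set us \<subseteq> carrier_vec n" for us x
    using that
  proof (induction us arbitrary: x)
    case Nil
    have "0\<^sub>v n \<in> span {}"
      using submodule.zero_closed[OF span_is_submodule[of "{}"]] by (simp add: module_vec_simps)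
    then show ?case using tr_zero Nil by auto
  next
    case (Cons u us)
    have mono: "span (set us) \<subseteq> span (set (u # us))" by (rule span_is_monotone) auto
    have uin: "u \<in> span (set (u # us))" using in_own_span[of "set (u # us)"] Cons.prems by auto
    from Cons.prems obtain y where y: "y \<in> lspan (map tr us)" "x = y \<or> x = tr u + y" by auto
    then obtain w where w: "w \<in> span (set us)" "tr w = y" using Cons by auto
    have wc: "w \<in> carrier_vec n" using w span_closed Cons.prems by auto
    show ?case
    proof (cases "x = y")
      case True
      then show ?thesis using w mono by auto
    next
      case False
      then have "tr (u + w) = x" using y w wc by (simp add: tr_add)
      moreover have "u + w \<in> span (set (u # us))"
        using span_add1[OF _ uin] w mono Cons.prems by auto
      ultimately show ?thesis by blast
    qed
  qed
  show ?thesis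
  proof
    assume "v \<in> span (set vs)"
    then show "tr v \<in> lspan (map tr vs)" using sub by blast
  next
    assume "tr v \<in> lspan (map tr vs)"
    then obtain w where w: "w \<in> span (set vs)" "tr w = tr v" using lift[OF _ vs] by blast
    then have "w \<in> carrier_vec n" using sub by blast
    then show "v \<in> span (set vs)" using inj_onD[OF inj_tr w(2)] v w(1) by blast
  qed
qed

lemma vspan_subset: "S \<subseteq> carrier_vec n \<Longrightarrow> vspan n S \<subseteq> carrier_vec n"
proof -
  interpret vec_space "TYPE(bit)" n .
  show "S \<subseteq> carrier_vec n \<Longrightarrow> vspan n S \<subseteq> carrier_vec n" using span_closed by auto
qed

lemma tr_image_span:
  assumes "set vs \<subseteq> carrier_vec n"
  shows "tr ` vspan n (set vs) = lspan (map tr vs)"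
proof
  show "tr ` vspan n (set vs) \<subseteq> lspan (map tr vs)"
    using span_iff_lspan[OF assms] vspan_subset[OF assms] by auto
  show "lspan (map tr vs) \<subseteq> tr ` vspan n (set vs)"
  proof
    fix x assume x: "x \<in> lspan (map tr vs)"
    have "set (map tr vs) \<subseteq> F" by auto
    then have "x \<in> F" using lspan_subset[OF subspace_F] x by blast
    then obtain v where "v \<in> carrier_vec n" "x = tr v" using tr_image by auto
    then show "x \<in> tr ` vspan n (set vs)" using span_iff_lspan[OF assms] x by auto
  qed
qed

lemma lindep_iff:
  assumes "set vs \<subseteq> carrier_vec n" "distinct vs"
  shows "vindep n (set vs) \<longleftrightarrow> lindep (map tr vs)"
  using assms
proof (induction vs)
  case Nil
  interpret vec_space "TYPE(bit)" n .
  show ?case by (simp add: lin_dep_def)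
next
  case (Cons v vs)
  interpret vec_space "TYPE(bit)" n .
  have v: "v \<in> carrier_vec n" "set vs \<subseteq> carrier_vec n" "v \<notin> set vs" using Cons.prems by auto
  have "lin_indpt (set (v # vs)) \<longleftrightarrow> lin_indpt (set vs) \<and> v \<notin> span (set vs)"
    using lin_dep_iff_in_span[of "set vs" v] v subset_li_is_li[of "set (v # vs)" "set vs"] by auto
  then show ?case using span_iff_lspan[OF v(2,1)] Cons by auto
qed

definition opm :: "bit mat \<Rightarrow> bvec \<Rightarrow> bvec" where
  "opm A y = (\<lambda>i. if i < n then \<Sum>j<n. A $$ (i, j) * y j else 0)"

lemma opm_F [simp]: "opm A y \<in> F"
  by (simp add: opm_def F_def)

lemma opm_mult_vec:
  assumes "A \<in> carrier_mat n n" "v \<in> carrier_vec n"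
  shows "opm A (tr v) = tr (A *\<^sub>v v)"
proof
  fix i
  have "(\<Sum>j<n. A $$ (i, j) * tr v j) = (\<Sum>j = 0..<n. A $$ (i, j) * v $ j)"
    by (rule sum.cong) (auto simp: tr_def)
  then show "opm A (tr v) i = tr (A *\<^sub>v v) i"
    using assms by (auto simp: opm_def tr_def scalar_prod_def)
qed

lemma opm_restrict: "opm A y = opm A (tr (vec n y))"
  by (auto simp: opm_def tr_def fun_eq_iff intro!: sum.cong)

lemma opm_plus:
  assumes "A \<in> carrier_mat n n" "B \<in> carrier_mat n n"
  shows "opm (A + B) y = opm A y + opm B y" "opm (A - B) y = opm A y + opm B y"
  using assms by (auto simp: opm_def fun_eq_iff plus_fun_apply algebra_simps sum.distrib)

lemma opm_one: "y \<in> F \<Longrightarrow> opm (1\<^sub>m n) y = y"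
proof -
  assume y: "y \<in> F"
  have "opm (1\<^sub>m n) (tr (vec n y)) = tr (vec n y)" by (subst opm_mult_vec) auto
  then show ?thesis using tr_vec[OF y] by simp
qed

lemma opm_inj:
  assumes "A \<in> carrier_mat n n" "B \<in> carrier_mat n n" "opm A = opm B"
  shows "A = B"
proof (rule eq_matI)
  have *: "opm M (unit j) i = M $$ (i, j)" if "i < n" "j < n" for M i j
  proof -
    have "(\<Sum>k<n. M $$ (i, k) * unit j k) = (\<Sum>k<n. if k = j then M $$ (i, k) else 0)"
      by (rule sum.cong) (auto simp: unit_def)
    then show ?thesis using that by (simp add: opm_def)
  qed
  fix i j assume "i < dim_row B" "j < dim_col B"
  then show "A $$ (i, j) = B $$ (i, j)" using assms(2) *[of i j A] *[of i j B] assms(3) by auto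
qed (use assms in auto)

lemma symop_opm:
  assumes A: "A \<in> carrier_mat n n" "transpose_mat A = A"
  shows "symop (opm A)"
proof -
  have sym: "A $$ (i, j) = A $$ (j, i)" if "i < n" "j < n" for i j
    using A that by (metis carrier_matD index_transpose_mat(1))
  have "dot x (opm A y) = dot (opm A x) y" for x y
  proof -
    have "dot x (opm A y) = (\<Sum>i<n. \<Sum>j<n. x i * (A $$ (i, j) * y j))"
      by (simp add: dot_def opm_def sum_distrib_left)
    also have "\<dots> = (\<Sum>j<n. \<Sum>i<n. x i * (A $$ (i, j) * y j))" by (rule sum.swap)
    also have "\<dots> = (\<Sum>j<n. \<Sum>i<n. (A $$ (j, i) * x i) * y j)"
      by (intro sum.cong refl) (auto simp: sym mult_ac)
    also have "\<dots> = dot (opm A x) y"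
      by (simp add: dot_def opm_def sum_distrib_right)
    finally show ?thesis .
  qed
  moreover have "opm A (x + y) = opm A x + opm A y" for x y
    by (auto simp: opm_def fun_eq_iff plus_fun_apply algebra_simps sum.distrib)
  ultimately show ?thesis by (auto simp: symop_def)
qed

lemma range_opm:
  assumes "A \<in> carrier_mat n n"
  shows "range (opm A) = tr ` {A *\<^sub>v v |v. v \<in> carrier_vec n}"
proof (intro equalityI subsetI)
  fix x assume "x \<in> range (opm A)"
  then obtain y where "x = opm A y" by auto
  then have "x = tr (A *\<^sub>v vec n y)" using opm_restrict[of A y] opm_mult_vec[OF assms, of "vec n y"] by simp
  then show "x \<in> tr ` {A *\<^sub>v v |v. v \<in> carrier_vec n}" using vec_carrier by blast
qed (auto simp: opm_mult_vec[OF assms, symmetric])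

text \<open>A maximal independent set of columns spans the column space, which \<open>tr\<close>
  carries onto the range; its size is both the rank and the exponent in
  \<open>card_lspan\<close>.\<close>

lemma card_range_opm:
  assumes A: "A \<in> carrier_mat n n"
  shows "card (range (opm A)) = 2 ^ rk n A"
proof -
  interpret vec_space "TYPE(bit)" n .
  let ?S = "set (cols A)"
  have S: "?S \<subseteq> carrier_vec n" using A cols_dim by blast
  obtain U where max: "maximal U (\<lambda>T. T \<subseteq> ?S \<and> lin_indpt T)"
    using maximal_exists_superset[of ?S "\<lambda>T. T \<subseteq> ?S \<and> lin_indpt T" "{}"]
    by (auto simp: lin_dep_def)
  then have U: "U \<subseteq> ?S" "lin_indpt U" by (simp_all add: maximal_def)
  have finU: "finite U" using U finite_subset by blast
  have Uc: "U \<subseteq> carrier_vec n" using U S by auto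
  have r: "rk n A = card U" unfolding rk_def by (rule rank_card_indpt[OF A max])
  have "?S \<subseteq> span U"
  proof
    fix s assume s: "s \<in> ?S"
    show "s \<in> span U"
    proof (rule ccontr)
      assume ns: "s \<notin> span U"
      then have "s \<notin> U" using in_own_span Uc by auto
      then have "lin_indpt (U \<union> {s})" using lin_dep_iff_in_span[of U s] Uc U ns s S by auto
      then have "U \<union> {s} = U" using max U s unfolding maximal_def by blast
      then show False using \<open>s \<notin> U\<close> by blast
    qed
  qed
  then have "span ?S \<subseteq> span U" using span_is_subset span_is_submodule Uc by auto
  then have sp: "span ?S = span U" using span_is_monotone U by blast
  obtain us where us: "set us = U" "distinct us" using finite_distinct_list[OF finU] by blast
  have "{A *\<^sub>v v |v. v \<in> carrier_vec n} = col_space A"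
    using A by (auto simp: col_space_eq[OF A])
  then have "range (opm A) = tr ` span U" using range_opm[OF A] sp by (simp add: col_space_def)
  also have "\<dots> = lspan (map tr us)" using tr_image_span us Uc by auto
  finally have "card (range (opm A)) = card (lspan (map tr us))" by simp
  also have "\<dots> = 2 ^ length us" using card_lspan lindep_iff us Uc U by fastforce
  finally show ?thesis using r us distinct_card by fastforce
qed

lemma invertible_iff_nonsing:
  assumes A: "A \<in> carrier_mat n n"
  shows "invertible_mat A \<longleftrightarrow> nonsing (opm (A - 1\<^sub>m n))"
proof -
  have "x + opm (A - 1\<^sub>m n) x = opm A x" if "x \<in> F" for x
    using that by (simp add: opm_plus[OF A] opm_one ac_simps)
  then have "nonsing (opm (A - 1\<^sub>m n)) \<longleftrightarrow> (\<forall>x\<in>F. opm A x = 0 \<longrightarrow> x = 0)"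
    by (simp add: nonsing_def)
  also have "\<dots> \<longleftrightarrow> (\<forall>v\<in>carrier_vec n. A *\<^sub>v v = 0\<^sub>v n \<longrightarrow> v = 0\<^sub>v n)"
    unfolding tr_image[symmetric] using A by (auto simp: opm_mult_vec tr_eq_zero_iff)
  also have "\<dots> \<longleftrightarrow> det A \<noteq> 0" using det_0_iff_vec_prod_zero_field[OF A] by auto
  also have "\<dots> \<longleftrightarrow> invertible_mat A"
  proof
    assume "det A \<noteq> 0"
    then obtain B where "B \<in> carrier_mat n n" "A * B = 1\<^sub>m n" "B * A = 1\<^sub>m n"
      using det_non_zero_imp_unit[OF A, of "()"] by (auto simp: Units_def ring_mat_def)
    then show "invertible_mat A" using A by (auto simp: invertible_mat_def inverts_mat_def square_mat.simps)
  next
    assume "invertible_mat A"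
    then obtain B where B: "A * B = 1\<^sub>m n" "B * A = 1\<^sub>m (dim_row B)"
      using A by (auto simp: invertible_mat_def inverts_mat_def)
    have "dim_col (A * B) = n" "dim_col (B * A) = dim_row B" by (simp_all only: B index_one_mat)
    then have "B \<in> carrier_mat n n" using A by auto
    then have "det A * det B = 1" using det_mult[OF A] B by (metis det_one)
    then show "det A \<noteq> 0" by (metis mult_zero_left zero_neq_one)
  qed
  finally show ?thesis by simp
qed

lemma opm_sq:
  assumes "x \<in> carrier_vec n"
  shows "opm (sq x) y = scl (dot (tr x) y) (tr x)" "sq x \<in> carrier_mat n n" "transpose_mat (sq x) = sq x"
proof -
  show "opm (sq x) y = scl (dot (tr x) y) (tr x)"
    using assms by (auto simp: opm_def sq_def fun_eq_iff scl_apply dot_def tr_def sum_distrib_left mult_ac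
      intro!: sum.cong)
  show "sq x \<in> carrier_mat n n" "transpose_mat (sq x) = sq x"
    using assms by (auto simp: sq_def mult.commute)
qed

end


section \<open>Edges, paths and distance of the graph in terms of operators\<close>

lemma two_power_inject: "(2::nat) ^ a = 2 ^ b \<Longrightarrow> a = b"
  by simp

context binary_space
begin

lemma opm_minus_one_inj:
  assumes A: "A \<in> carrier_mat n n" and B: "B \<in> carrier_mat n n"
    and eq: "opm (A - 1\<^sub>m n) = opm (B - 1\<^sub>m n)"
  shows "A = B"
proof (rule opm_inj[OF A B])
  show "opm A = opm B"
  proof
    fix y
    have "opm A y + opm (1\<^sub>m n) y = opm B y + opm (1\<^sub>m n) y"
      using fun_cong[OF eq, of y] by (simp only: opm_plus(2)[OF A one_carrier_mat] opm_plus(2)[OF B one_carrier_mat])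
    then show "opm A y = opm B y" by simp
  qed
qed

lemma SGL_iff:
  assumes A: "A \<in> carrier_mat n n"
  shows "A \<in> SGL n \<longleftrightarrow> symop (opm (A - 1\<^sub>m n)) \<and> nonsing (opm (A - 1\<^sub>m n))"
proof -
  have M: "A - 1\<^sub>m n \<in> carrier_mat n n" by auto
  have "transpose_mat A = A \<longleftrightarrow> symop (opm (A - 1\<^sub>m n))"
  proof
    assume T: "transpose_mat A = A"
    have "transpose_mat (A - 1\<^sub>m n) = A - 1\<^sub>m n"
    proof (rule eq_matI)
      fix i j assume "i < dim_row (A - 1\<^sub>m n)" "j < dim_col (A - 1\<^sub>m n)"
      moreover have "A $$ (j, i) = A $$ (i, j)" if "i < n" "j < n"
        using T A that by (metis carrier_matD index_transpose_mat(1))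
      ultimately show "transpose_mat (A - 1\<^sub>m n) $$ (i, j) = (A - 1\<^sub>m n) $$ (i, j)" using A by auto
    qed auto
    then show "symop (opm (A - 1\<^sub>m n))" using symop_opm[OF M] by simp
  next
    assume s: "symop (opm (A - 1\<^sub>m n))"
    have *: "dot (unit i) (opm N (unit j)) = N $$ (i, j)" if "i < n" "j < n" for i j N
    proof -
      have "(\<Sum>k<n. N $$ (i, k) * unit j k) = (\<Sum>k<n. if k = j then N $$ (i, k) else 0)"
        by (rule sum.cong) (auto simp: unit_def)
      then show ?thesis using that by (simp add: dot_unit opm_def)
    qed
    show "transpose_mat A = A"
    proof (rule eq_matI)
      fix i j assume "i < dim_row A" "j < dim_col A"
      then have ij: "i < n" "j < n" using A by auto
      have "(A - 1\<^sub>m n) $$ (i, j) = (A - 1\<^sub>m n) $$ (j, i)"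
        using symop_adj[OF s, of "unit i" "unit j"] *[OF ij] *[OF ij(2,1)] by (simp add: dot_commute)
      then show "transpose_mat A $$ (i, j) = A $$ (i, j)"
        using A ij by (cases "i = j") auto
    qed (use A in auto)
  qed
  then show ?thesis using A invertible_iff_nonsing[OF A] by (simp add: SGL_def)
qed

lemma conn_nonsing: "conn k D \<Longrightarrow> nonsing D"
  by (induction rule: conn.induct) (auto simp: nonsing_def)

lemma upd_opm:
  assumes A: "A \<in> carrier_mat n n" and x: "x \<in> carrier_vec n"
  shows "upd (opm A) (tr x) = opm (A + sq x)"
  by (auto simp: upd_def opm_plus(1)[OF A opm_sq(2)[OF x]] opm_sq(1)[OF x])

lemma opm_add_minus_one:
  assumes A: "A \<in> carrier_mat n n" and B: "B \<in> carrier_mat n n"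
  shows "opm (A + B - 1\<^sub>m n) = opm ((A - 1\<^sub>m n) + B)"
  using A B by (intro ext[of "opm (A + B - 1\<^sub>m n)"]) (simp add: opm_plus minus_carrier_mat ac_simps)

text \<open>A symmetric matrix of rank one is not alternating, so \<open>diagonal_basis\<close>
  writes it as a single square.\<close>

lemma edge_iff:
  assumes A: "A \<in> SGL n" and B: "B \<in> SGL n"
  shows "rk n (A - B) = 1 \<longleftrightarrow> (\<exists>x\<in>F. x \<noteq> 0 \<and> opm (B - 1\<^sub>m n) = upd (opm (A - 1\<^sub>m n)) x)"
proof -
  have Ac: "A \<in> carrier_mat n n" and Bc: "B \<in> carrier_mat n n" using A B by (auto simp: SGL_def)
  have Mc: "A - B \<in> carrier_mat n n" using Bc by auto
  have sum: "opm (A - B) y = opm (A - 1\<^sub>m n) y + opm (B - 1\<^sub>m n) y" for y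
    using Ac Bc by (simp add: opm_plus ac_simps)
  have sA: "symop (opm (A - 1\<^sub>m n))" and sB: "symop (opm (B - 1\<^sub>m n))"
    using SGL_iff[OF Ac] SGL_iff[OF Bc] A B by auto
  have sM: "symop (opm (A - B))"
    using sA sB unfolding symop_def by (auto simp: sum ac_simps)
  have card: "card (range (opm (A - B))) = 2 ^ rk n (A - B)" by (rule card_range_opm[OF Mc])
  show ?thesis
  proof
    assume r: "rk n (A - B) = 1"
    then have "dg (opm (A - B)) \<noteq> 0" using dg_rank_one[OF sM] card by simp
    then obtain xs where xs: "opm (A - B) = opl xs" "lindep xs" "lspan xs = range (opm (A - B))" "set xs \<subseteq> F"
      using diagonal_basis[OF sM card] by blast
    have "(2::nat) ^ length xs = 2 ^ 1" using card_lspan[OF xs(2)] xs(3) card r by simp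
    then have "length xs = 1" by (rule two_power_inject)
    then obtain x where x: "xs = [x]" by (cases xs) auto
    have "opm (B - 1\<^sub>m n) = upd (opm (A - 1\<^sub>m n)) x"
    proof
      fix y
      have "opm (A - 1\<^sub>m n) y + opm (B - 1\<^sub>m n) y = scl (dot x y) x"
        using fun_cong[OF xs(1), of y] by (simp add: sum x upd_def)
      then show "opm (B - 1\<^sub>m n) y = upd (opm (A - 1\<^sub>m n)) x y"
        unfolding upd_def by (metis bvec_double(2))
    qed
    then show "\<exists>x\<in>F. x \<noteq> 0 \<and> opm (B - 1\<^sub>m n) = upd (opm (A - 1\<^sub>m n)) x"
      using xs(2,4) x by auto
  next
    assume "\<exists>x\<in>F. x \<noteq> 0 \<and> opm (B - 1\<^sub>m n) = upd (opm (A - 1\<^sub>m n)) x"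
    then obtain x where x: "x \<in> F" "x \<noteq> 0" "opm (B - 1\<^sub>m n) = upd (opm (A - 1\<^sub>m n)) x" by blast
    have "opm (A - B) = opl [x]"
      using x(3) by (intro ext) (simp add: sum upd_def)
    then have "card (range (opm (A - B))) = 2 ^ 1"
      using range_opl[of "[x]"] card_lspan[of "[x]"] x by simp
    then have "(2::nat) ^ rk n (A - B) = 2 ^ 1" using card by simp
    then show "rk n (A - B) = 1" by (rule two_power_inject)
  qed
qed

lemma path_iff_conn:
  assumes "A \<in> SGL n"
  shows "(A, 1\<^sub>m n) \<in> Gamma_edge n ^^ k \<longleftrightarrow> conn k (opm (A - 1\<^sub>m n))"
  using assms
proof (induction k arbitrary: A)
  case 0
  then have A: "A \<in> carrier_mat n n" by (simp add: SGL_def)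
  have z: "opm (1\<^sub>m n - 1\<^sub>m n) = (\<lambda>_. 0)" by (intro ext) (simp add: opm_plus)
  show ?case
  proof
    assume "(A, 1\<^sub>m n) \<in> Gamma_edge n ^^ 0"
    then have "A = 1\<^sub>m n" by simp
    then show "conn 0 (opm (A - 1\<^sub>m n))" using z conn_zero by (simp only:)
  next
    assume "conn 0 (opm (A - 1\<^sub>m n))"
    then have "opm (A - 1\<^sub>m n) = (\<lambda>_. 0)" by cases auto
    then have "A = 1\<^sub>m n" using opm_minus_one_inj[OF A] z by simp
    then show "(A, 1\<^sub>m n) \<in> Gamma_edge n ^^ 0" by simp
  qed
next
  case (Suc k)
  then have A: "A \<in> carrier_mat n n" by (simp add: SGL_def)
  note sA = SGL_iff[OF A, THEN iffD1, OF Suc.prems]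
  show ?case
  proof
    assume "(A, 1\<^sub>m n) \<in> Gamma_edge n ^^ Suc k"
    then obtain B where B: "(A, B) \<in> Gamma_edge n" "(B, 1\<^sub>m n) \<in> Gamma_edge n ^^ k"
      by (meson relpow_Suc_D2)
    then have Bs: "B \<in> SGL n" "rk n (A - B) = 1" by (auto simp: Gamma_edge_def)
    obtain x where x: "x \<in> F" "x \<noteq> 0" "opm (B - 1\<^sub>m n) = upd (opm (A - 1\<^sub>m n)) x"
      using edge_iff[OF Suc.prems Bs(1)] Bs(2) by blast
    then show "conn (Suc k) (opm (A - 1\<^sub>m n))"
      using conn_Suc[of k "opm (A - 1\<^sub>m n)" x] Suc.IH[OF Bs(1)] B(2) sA by simp
  next
    assume "conn (Suc k) (opm (A - 1\<^sub>m n))"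
    then obtain x where x: "x \<in> F" "x \<noteq> 0" "conn k (upd (opm (A - 1\<^sub>m n)) x)" by cases auto
    define B where "B = A + sq (vec n x)"
    have sq: "sq (vec n x) \<in> carrier_mat n n" using opm_sq(2)[of "vec n x"] by simp
    have Bc: "B \<in> carrier_mat n n" unfolding B_def using A sq by auto
    have Bx: "opm (B - 1\<^sub>m n) = upd (opm (A - 1\<^sub>m n)) x"
      unfolding B_def opm_add_minus_one[OF A sq]
      using upd_opm[of "A - 1\<^sub>m n" "vec n x"] tr_vec[OF x(1)] by (simp add: minus_carrier_mat)
    have Bs: "B \<in> SGL n"
      using SGL_iff[OF Bc] symop_upd[of "opm (A - 1\<^sub>m n)" x] sA x(1) conn_nonsing[OF x(3)] Bx by simp
    then have "(A, B) \<in> Gamma_edge n"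
      using edge_iff[OF Suc.prems Bs] x Bx Suc.prems by (auto simp: Gamma_edge_def)
    moreover have "(B, 1\<^sub>m n) \<in> Gamma_edge n ^^ k" using Suc.IH[OF Bs] Bx x(3) by simp
    ultimately show "(A, 1\<^sub>m n) \<in> Gamma_edge n ^^ Suc k" by (rule relpow_Suc_I2)
  qed
qed

lemma gdist_iff:
  assumes "A \<in> SGL n"
  shows "gdist n A (1\<^sub>m n) = enat m
    \<longleftrightarrow> conn m (opm (A - 1\<^sub>m n)) \<and> (\<forall>k<m. \<not> conn k (opm (A - 1\<^sub>m n)))"
proof -
  let ?S = "{enat k |k. conn k (opm (A - 1\<^sub>m n))}"
  have g: "gdist n A (1\<^sub>m n) = Inf ?S" by (simp add: gdist_def path_iff_conn[OF assms])
  show ?thesis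
  proof
    assume "gdist n A (1\<^sub>m n) = enat m"
    then have I: "Inf ?S = enat m" using g by simp
    \<comment> \<open>The infimum of the empty set is infinite, so a finite distance is attained by
      some path.\<close>
    have "?S \<noteq> {}"
    proof
      assume "?S = {}"
      then have "Inf ?S = \<infinity>" by (simp only: Inf_enat_def simp_thms if_True)
      then show False using I by simp
    qed
    then have "Inf ?S \<in> ?S" unfolding Inf_enat_def by (metis (mono_tags, lifting) LeastI ex_in_conv)
    then have "conn m (opm (A - 1\<^sub>m n))" unfolding I by auto
    moreover have "\<not> conn k (opm (A - 1\<^sub>m n))" if "k < m" for k
    proof
      assume "conn k (opm (A - 1\<^sub>m n))"
      then have "Inf ?S \<le> enat k" by (intro Inf_lower) auto
      then show False using I that by simp
    qed
    ultimately show "conn m (opm (A - 1\<^sub>m n)) \<and> (\<forall>k<m. \<not> conn k (opm (A - 1\<^sub>m n)))" by blast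
  next
    assume c: "conn m (opm (A - 1\<^sub>m n)) \<and> (\<forall>k<m. \<not> conn k (opm (A - 1\<^sub>m n)))"
    have "Inf ?S = enat m"
    proof (rule antisym)
      show "Inf ?S \<le> enat m" using c by (intro Inf_lower) auto
      show "enat m \<le> Inf ?S" using c by (intro Inf_greatest) (auto simp: not_less[symmetric])
    qed
    then show "gdist n A (1\<^sub>m n) = enat m" using g by simp
  qed
qed

section \<open>Self-dual codes\<close>

lemma scalar_prod_split:
  assumes "x \<in> carrier_vec (n + 1)" "y \<in> carrier_vec (n + 1)"
  shows "x \<bullet> y = dot (tr x) (tr y) + x $ n * y $ n"
proof -
  have "x \<bullet> y = (\<Sum>i<Suc n. x $ i * y $ i)"
    using assms by (simp add: scalar_prod_def lessThan_atLeast0)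
  also have "\<dots> = (\<Sum>i<n. tr x i * tr y i) + x $ n * y $ n" by (simp add: tr_def)
  finally show ?thesis by (simp add: dot_def)
qed

text \<open>In a self-dual code y.y = 0 makes the last entry the parity of the others. Truncation
  therefore loses nothing on such codes, and this is its inverse.\<close>

definition parity_lift :: "bvec \<Rightarrow> bit vec" where
  "parity_lift x = vec (n + 1) (\<lambda>i. if i < n then x i else dot ones x)"

lemma parity_lift_carrier: "parity_lift x \<in> carrier_vec (n + 1)"
  and parity_lift_last: "parity_lift x $ n = dot ones x"
  by (simp_all add: parity_lift_def)

lemma tr_parity_lift: "x \<in> F \<Longrightarrow> tr (parity_lift x) = x"
  by (auto simp: parity_lift_def tr_def F_def fun_eq_iff)

lemma parity_lift_eqI:
  assumes "y \<in> carrier_vec (n + 1)" "y $ n = dot ones (tr y)"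
  shows "parity_lift (tr y) = y"
proof (rule eq_vecI)
  fix i assume "i < dim_vec y"
  then show "parity_lift (tr y) $ i = y $ i"
    using assms by (cases "i = n") (auto simp: parity_lift_def tr_def)
qed (use assms in \<open>auto simp: parity_lift_def\<close>)

text \<open>For the size, a vector orthogonal to the truncated code, extended by 0, is orthogonal to
  \<open>C\<close> and so belongs to it. The orthogonal complement of the truncation is thus its
  even-weight part. This part is a proper hyperplane: if no codeword ended in 1, the last unit
  vector would be orthogonal to \<open>C\<close>, hence a codeword ending in 1.\<close>

lemma self_dualD:
  assumes sd: "self_dual (n + 1) C"
  shows "C \<subseteq> carrier_vec (n + 1)"
    and "x \<in> C \<Longrightarrow> y \<in> C \<Longrightarrow> x + y \<in> C"
    and "y \<in> C \<Longrightarrow> y $ n = dot ones (tr y)"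
    and "C = parity_lift ` (tr ` C)"
    and "subspace (tr ` C)"
    and "special (tr ` C)"
    and "\<exists>v\<in>tr ` C. dot ones v = 1"
    and "card (tr ` C) * card (tr ` C) = 2 ^ (n + 1)"
proof -
  have mem: "y \<in> C \<longleftrightarrow> y \<in> carrier_vec (n + 1) \<and> (\<forall>z\<in>C. y \<bullet> z = 0)" for y
    using sd unfolding self_dual_def dual_code_def by blast
  have orth: "x \<bullet> y = 0" if "x \<in> C" "y \<in> C" for x y using mem that by blast
  show sub: "C \<subseteq> carrier_vec (n + 1)" using mem by blast
  show add: "x + y \<in> C" if "x \<in> C" "y \<in> C" for x y
    unfolding mem
  proof (intro conjI ballI)
    fix z assume z: "z \<in> C"
    have "(x + y) \<bullet> z = x \<bullet> z + y \<bullet> z"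
      using that z sub by (intro add_scalar_prod_distrib[of _ "n + 1"]) auto
    then show "(x + y) \<bullet> z = 0" using orth that z by simp
  qed (use that sub add_carrier_vec in blast)
  have prod: "dot (tr x) (tr y) = x $ n * y $ n" if "x \<in> C" "y \<in> C" for x y
    using scalar_prod_split[of x y] that sub orth[OF that] by (auto simp: bit_sum_eq_iff)
  show last: "y $ n = dot ones (tr y)" if "y \<in> C" for y
    using prod[OF that that] by (cases "y $ n") (simp_all add: dot_ones)
  show "C = parity_lift ` (tr ` C)"
    using parity_lift_eqI last sub by (force simp: image_image)
  have "0\<^sub>v (n + 1) \<in> C" unfolding mem using sub by auto
  moreover have "tr (0\<^sub>v (n + 1)) = 0" by (auto simp: tr_def fun_eq_iff zero_fun_apply)
  ultimately have "0 \<in> tr ` C" by (metis image_eqI)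
  moreover have "u + v \<in> tr ` C" if uv: "u \<in> tr ` C" "v \<in> tr ` C" for u v
  proof -
    obtain x y where xy: "x \<in> C" "y \<in> C" "u = tr x" "v = tr y" using uv by auto
    then have "u + v = tr (x + y)" using sub by (subst tr_add) auto
    then show ?thesis using add xy by auto
  qed
  ultimately show V: "subspace (tr ` C)" by (auto simp: subspace_def)
  show sp: "special (tr ` C)" using prod last by (auto simp: special_def)
  show ex: "\<exists>v\<in>tr ` C. dot ones v = 1"
  proof (rule ccontr)
    assume "\<not> ?thesis"
    then have z0: "y $ n = 0" if "y \<in> C" for y using last that by auto
    have "unit_vec (n + 1) n \<bullet> y = 0" if "y \<in> C" for y
      using that sub z0[OF that] by (subst scalar_prod_left_unit) auto
    then have "unit_vec (n + 1) n \<in> C" using mem unit_vec_carrier by blast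
    from z0[OF this] show False by simp
  qed
  have "perp (tr ` C) = {v \<in> tr ` C. dot ones v = 0}"
  proof (intro equalityI subsetI)
    fix x assume x: "x \<in> perp (tr ` C)"
    then have xF: "x \<in> F" by (simp add: perp_def)
    let ?y = "vec (n + 1) x"
    have tx: "tr ?y = x" using xF by (auto simp: tr_def F_def fun_eq_iff)
    have yn: "?y $ n = 0" using xF by (simp add: F_def)
    have "?y \<in> C" unfolding mem
    proof (intro conjI ballI)
      fix z assume z: "z \<in> C"
      have "?y \<bullet> z = dot x (tr z) + ?y $ n * z $ n"
        using scalar_prod_split[of ?y z] z sub tx by auto
      then show "?y \<bullet> z = 0" using yn x z by (simp add: perp_def)
    qed simp
    then have "x \<in> tr ` C" "dot ones x = 0" using tx last[of ?y] yn by (metis image_eqI, metis)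
    then show "x \<in> {v \<in> tr ` C. dot ones v = 0}" by simp
  next
    fix v assume "v \<in> {v \<in> tr ` C. dot ones v = 0}"
    then show "v \<in> perp (tr ` C)" using sp by (auto simp: special_def perp_def)
  qed
  moreover obtain u where u: "u \<in> tr ` C" "dot ones u = 1" using ex by blast
  ultimately have "card (tr ` C) = 2 * card (perp (tr ` C))" using card_hyperplane[OF V u] by simp
  then have "card (tr ` C) * card (tr ` C) = 2 * (card (tr ` C) * card (perp (tr ` C)))" by simp
  also have "\<dots> = 2 ^ (n + 1)" using card_perp[OF V] by simp
  finally show "card (tr ` C) * card (tr ` C) = 2 ^ (n + 1)" .
qed

text \<open>The even-weight part of \<open>V\<close> lies in \<open>perp V\<close>, and the size
  forces equality, so 1 lies in the double complement, which is \<open>V\<close>. A vector of the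
  dual code with last entry b satisfies tr x + b 1 \<in> \<open>perp V\<close>; as \<open>n\<close>
  is odd, this makes b the parity of \<open>tr x\<close> and puts \<open>tr x\<close> into
  \<open>V\<close>.\<close>

lemma self_dual_parity_lift:
  assumes V: "subspace V" and sp: "special V" and c: "card V * card V = 2 ^ (n + 1)" and n: "odd n"
  shows "self_dual (n + 1) (parity_lift ` V)"
proof -
  have VF: "V \<subseteq> F" using subspaceD[OF V] by simp
  have trV: "tr (parity_lift v) = v" if "v \<in> V" for v using tr_parity_lift VF that by blast
  have cpos: "card V \<noteq> 0" using c by (metis mult_zero_left power_not_zero zero_neq_numeral)
  let ?V0 = "{v \<in> V. dot ones v = 0}"
  have sub: "?V0 \<subseteq> perp V" using sp VF by (auto simp: special_def perp_def)
  have finp: "finite (perp V)" using subspaceD[OF subspace_perp[of V]] by simp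
  have two: "card V = 2 * card (perp V)"
  proof -
    have "card V * card V = card V * (2 * card (perp V))" using c card_perp[OF V] by simp
    then show ?thesis using cpos by simp
  qed
  have "\<exists>u\<in>V. dot ones u = 1"
  proof (rule ccontr)
    assume "\<not> ?thesis"
    then have "?V0 = V" by auto
    then have "card V \<le> card (perp V)" using card_mono[OF finp sub] by simp
    then show False using two cpos by simp
  qed
  then have "card V = 2 * card ?V0" using card_hyperplane[OF V] by blast
  then have "card (perp V) \<le> card ?V0" using two by linarith
  then have V0: "perp V = ?V0" using card_seteq[OF finp sub] by blast
  have "ones \<in> perp (perp V)" unfolding V0 by (auto simp: perp_def)
  then have onesV: "ones \<in> V" using perp_perp[OF V] by simp
  have "parity_lift ` V = dual_code (n + 1) (parity_lift ` V)"
  proof (intro equalityI subsetI)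
    fix x assume "x \<in> parity_lift ` V"
    then obtain u where u: "x = parity_lift u" "u \<in> V" by auto
    have "x \<bullet> parity_lift v = 0" if "v \<in> V" for v
    proof -
      have "dot u v = dot ones u * dot ones v" using sp u that by (simp add: special_def)
      then show ?thesis
        using scalar_prod_split[OF parity_lift_carrier parity_lift_carrier, of u v] u that
        by (simp add: trV parity_lift_last)
    qed
    then show "x \<in> dual_code (n + 1) (parity_lift ` V)"
      unfolding dual_code_def using u parity_lift_carrier by blast
  next
    fix x assume x: "x \<in> dual_code (n + 1) (parity_lift ` V)"
    then have xc: "x \<in> carrier_vec (n + 1)" by (simp add: dual_code_def)
    define b where "b = x $ n"
    have "dot (tr x) v + b * dot ones v = 0" if "v \<in> V" for v
    proof -
      have "x \<bullet> parity_lift v = 0" using x that by (simp add: dual_code_def)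
      then show ?thesis
        using scalar_prod_split[OF xc parity_lift_carrier, of v] that
        by (simp add: trV parity_lift_last b_def)
    qed
    then have "tr x + scl b ones \<in> perp V" by (simp add: perp_def)
    then have w: "tr x + scl b ones \<in> V" "dot ones (tr x + scl b ones) = 0" unfolding V0 by auto
    then have "dot ones (tr x) = b" using dot_ones_ones[OF n] by (simp add: bit_sum_eq_iff)
    then have "parity_lift (tr x) = x" using parity_lift_eqI[OF xc] by (simp add: b_def)
    moreover have "tr x \<in> V"
      using subspaceD(3)[OF V w(1) subspace_scl[OF V onesV, of b]] by (simp add: add.assoc)
    ultimately show "x \<in> parity_lift ` V" by (metis image_eqI)
  qed
  then show ?thesis unfolding self_dual_def using parity_lift_carrier by blast
qed


section \<open>Bases of a self-dual code and the matrices of its class\<close>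

definition cut :: "bvec \<Rightarrow> bvec" where
  "cut x = (\<lambda>i. if i < n then x i else 0)"

lemma cut_add: "cut (x + y) = cut x + cut y"
  by (auto simp: cut_def fun_eq_iff plus_fun_apply)

lemma cut_tr: "cut (binary_space.tr (n + 1) v) = tr v"
  by (auto simp: cut_def tr_def binary_space.tr_def fun_eq_iff)

text \<open>Span and independence of codewords live in length n + 1 and are translated by the second
  locale instance \<open>W\<close>. Since the last entry is a parity, \<open>cut\<close> is
  injective on the code, and both properties carry over to the truncations.\<close>

lemma bases_iff:
  assumes sd: "self_dual (n + 1) C" and bs: "distinct bs" "set bs \<subseteq> C"
  shows "set bs \<in> bases (n + 1) C \<longleftrightarrow> lindep (map tr bs) \<and> lspan (map tr bs) = tr ` C"
proof -
  interpret W: binary_space "n + 1" .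
  note C = self_dualD[OF sd]
  have bsc: "set bs \<subseteq> carrier_vec (n + 1)" using bs C(1) by auto
  let ?ys = "map W.tr bs"
  have trC: "cut ` W.tr ` C = tr ` C" by (simp only: image_image cut_tr)
  have map_tr: "map tr bs = map cut ?ys" by (simp only: map_map comp_def cut_tr)
  have "inj_on tr C"
  proof (rule inj_onI)
    fix x y assume "x \<in> C" "y \<in> C" "tr x = tr y"
    then show "x = y" using C(1,3) parity_lift_eqI by (metis subsetD)
  qed
  then have "inj_on (cut \<circ> W.tr) C" by (simp only: comp_def cut_tr)
  then have inj: "inj_on cut (W.tr ` C)" by (rule inj_on_imageI)
  have "0 \<in> tr ` C" using subspaceD(2)[OF C(5)] .
  have C0: "0\<^sub>v (n + 1) \<in> C"
  proof -
    obtain c where "c \<in> C" using \<open>0 \<in> tr ` C\<close> by auto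
    then have "c + c \<in> C" using C(2) by blast
    moreover have "c + c = 0\<^sub>v (n + 1)" using \<open>c \<in> C\<close> C(1) by (intro eq_vecI) auto
    ultimately show ?thesis by simp
  qed
  have sub: "W.subspace (W.tr ` C)"
    unfolding W.subspace_def
  proof (intro conjI ballI)
    show "0 \<in> W.tr ` C" using C0 W.tr_zero by (metis image_eqI)
    fix x y assume "x \<in> W.tr ` C" "y \<in> W.tr ` C"
    then obtain a b where ab: "a \<in> C" "b \<in> C" "x = W.tr a" "y = W.tr b" by auto
    then have "x + y = W.tr (a + b)" using C(1) by (subst W.tr_add) auto
    then show "x + y \<in> W.tr ` C" using C(2) ab by auto
  qed (use W.tr_F in blast)
  have ysC: "lspan ?ys \<subseteq> W.tr ` C" using bs(2) by (intro W.lspan_subset[OF sub]) auto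
  have inj': "inj_on cut (lspan ?ys)" using inj ysC inj_on_subset by blast
  have "vspan (n + 1) (set bs) = C \<longleftrightarrow> lspan ?ys = W.tr ` C"
    unfolding W.tr_image_span[OF bsc, symmetric]
    using inj_on_image_eq_iff[OF W.inj_tr W.vspan_subset[OF bsc] C(1)] by simp
  also have "\<dots> \<longleftrightarrow> cut ` lspan ?ys = cut ` W.tr ` C"
    using inj_on_image_eq_iff[OF inj ysC] by simp
  also have "\<dots> \<longleftrightarrow> lspan (map tr bs) = tr ` C"
    unfolding map_tr lspan_map[OF cut_add] trC ..
  finally have span: "vspan (n + 1) (set bs) = C \<longleftrightarrow> lspan (map tr bs) = tr ` C" .
  have "vindep (n + 1) (set bs) \<longleftrightarrow> lindep (map tr bs)"
    by (simp only: W.lindep_iff[OF bsc bs(1)] map_tr lindep_map[OF cut_add inj'])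
  then show ?thesis
    unfolding bases_def is_basis_def mem_Collect_eq using bs(2) span List.finite_set by blast
qed

lemma mat_sum_insert:
  assumes "finite B" "b \<notin> B" "f b \<in> carrier_mat n n"
  shows "mat_sum n f (insert b B) = mat_sum n f B + f b"
  using assms by (intro eq_matI) (auto simp: mat_sum_def add.commute)

lemma mat_sum_carrier [simp]: "mat_sum n f B \<in> carrier_mat n n"
  by (simp add: mat_sum_def)

lemma under_carrier [simp]: "under n y \<in> carrier_vec n"
  by (simp add: under_def)

lemma tr_under [simp]: "tr (under n y) = tr y"
  by (auto simp: tr_def under_def)

lemma opm_mat_sum:
  "distinct bs \<Longrightarrow> opm (mat_sum n (\<lambda>y. sq (under n y)) (set bs)) = opl (map tr bs)"
proof (induction bs)
  case Nil
  have "opm (mat_sum n (\<lambda>y. sq (under n y)) {}) y = 0" for y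
    by (auto simp: opm_def mat_sum_def fun_eq_iff zero_fun_apply)
  then show ?case by (intro ext[of "opm _"]) simp
next
  case (Cons b bs)
  then show ?case
    using mat_sum_insert[of "set bs" b "\<lambda>y. sq (under n y)"] opm_sq(2)[of "under n b"]
      upd_opm[of "mat_sum n (\<lambda>y. sq (under n y)) (set bs)" "under n b"] by simp
qed

lemma tr_vec_sum: "distinct bs \<Longrightarrow> tr (vec_sum n (under n) (set bs)) = comb (\<lambda>_. 1) (map tr bs)"
proof (induction bs)
  case Nil
  show ?case by (auto simp: tr_def vec_sum_def fun_eq_iff zero_fun_apply)
next
  case (Cons b bs)
  have "tr (vec_sum n (under n) (insert b (set bs))) = tr b + tr (vec_sum n (under n) (set bs))"
    using Cons.prems by (auto simp: tr_def vec_sum_def under_def fun_eq_iff plus_fun_apply)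
  then show ?case using Cons by simp
qed

lemma vec_sum_carrier [simp]: "vec_sum n f B \<in> carrier_vec n"
  by (simp add: vec_sum_def)

lemma A1_opm:
  assumes "distinct bs"
  shows "A1 n (set bs) \<in> carrier_mat n n" "opm (A1 n (set bs) - 1\<^sub>m n) = opl (map tr bs)"
proof -
  show "A1 n (set bs) \<in> carrier_mat n n" by (simp add: A1_def)
  show "opm (A1 n (set bs) - 1\<^sub>m n) = opl (map tr bs)"
    unfolding opm_mat_sum[OF assms, symmetric] A1_def
    by (intro ext[of "opm _"]) (simp add: opm_plus ac_simps)
qed

lemma A2_opm:
  assumes "distinct bs"
  shows "A2 n (set bs) \<in> carrier_mat n n"
    "opm (A2 n (set bs) - 1\<^sub>m n) = upd (opl (map tr bs)) (comb (\<lambda>_. 1) (map tr bs))"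
proof -
  have sq: "sq (vec_sum n (under n) (set bs)) \<in> carrier_mat n n" by (rule opm_sq(2)) simp
  have A: "A1 n (set bs) \<in> carrier_mat n n" by (rule A1_opm[OF assms])
  have A2: "A2 n (set bs) = A1 n (set bs) + sq (vec_sum n (under n) (set bs))"
    by (simp add: A2_def A1_def)
  show "A2 n (set bs) \<in> carrier_mat n n" unfolding A2 using A sq by simp
  show "opm (A2 n (set bs) - 1\<^sub>m n) = upd (opl (map tr bs)) (comb (\<lambda>_. 1) (map tr bs))"
    unfolding A2 opm_add_minus_one[OF A sq] A1_opm(2)[OF assms, symmetric] tr_vec_sum[OF assms, symmetric]
    by (rule upd_opm[symmetric]) (simp_all add: minus_carrier_mat)
qed

lemma sum_last_parity:
  "distinct bs \<Longrightarrow> (\<Sum>b\<leftarrow>bs. b $ n) = (0::bit) \<longleftrightarrow> even (card {y \<in> set bs. y $ n = 1})"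
proof (induction bs)
  case (Cons b bs)
  have "{y \<in> set (b # bs). y $ n = 1} = (if b $ n = 1 then insert b {y \<in> set bs. y $ n = 1}
      else {y \<in> set bs. y $ n = 1})" by auto
  then show ?case using Cons by (cases "b $ n") (auto simp: bit_sum_eq_iff)
qed simp

text \<open>With D = A + I, the class is cut out by the column space of \<open>D\<close>. A
  non-alternating \<open>D\<close> is a sum of squares over a basis, invertible iff the number of
  odd truncations is even, which is the condition in \<open>bases2\<close>. An alternating
  \<open>D\<close> has the square of the total added and requires even dimension.\<close>

lemma FC_eq:
  assumes sd: "self_dual (n + 1) C" and n: "odd n"
  shows "FC n C = {A \<in> SGL n. range (opm (A - 1\<^sub>m n)) = tr ` C}"
proof -
  note C = self_dualD[OF sd]
  define m where "m = (n + 1) div 2"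
  have m: "n + 1 = m + m" "0 < m" using n by (auto simp: m_def elim!: oddE)
  have cV: "card (tr ` C) = 2 ^ m"
  proof -
    have "card (tr ` C) ^ 2 = (2 ^ m) ^ 2" using C(8) unfolding m(1) by (simp add: power2_eq_square power_add)
    then show ?thesis by simp
  qed
  have ones_tr: "(\<Sum>x\<leftarrow>map tr bs. dot ones x) = (\<Sum>b\<leftarrow>bs. b $ n)" if "set bs \<subseteq> C" for bs
    using that C(3) by (induction bs) auto
  have len: "length xs = m" if "lindep xs" "lspan xs = tr ` C" for xs
    using card_lspan[OF that(1)] that(2) cV by simp
  have VF: "tr ` C \<subseteq> F" by auto
  have memI: "A \<in> {A \<in> SGL n. range (opm (A - 1\<^sub>m n)) = tr ` C}"
    if "A \<in> carrier_mat n n" "symop (opm (A - 1\<^sub>m n))" "nonsing (opm (A - 1\<^sub>m n))"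
      "range (opm (A - 1\<^sub>m n)) = tr ` C" for A
    using that SGL_iff by simp
  have in1: "A1 n B \<in> {A \<in> SGL n. range (opm (A - 1\<^sub>m n)) = tr ` C}" if B: "B \<in> bases2 n C" for B
  proof -
    have "finite B" "B \<subseteq> C" using B by (auto simp: bases2_def bases_def is_basis_def)
    then obtain bs where bs: "set bs = B" "distinct bs" using finite_distinct_list by blast
    have bC: "set bs \<subseteq> C" using bs \<open>B \<subseteq> C\<close> by simp
    have b: "lindep (map tr bs)" "lspan (map tr bs) = tr ` C"
      using bases_iff[OF sd bs(2) bC] B bs(1) by (auto simp: bases2_def)
    have xF: "set (map tr bs) \<subseteq> F" by auto
    have "(\<Sum>b\<leftarrow>bs. b $ n) = 0" using sum_last_parity[OF bs(2)] B bs(1) by (simp add: bases2_def)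
    then have ns: "nonsing (opl (map tr bs))"
      using nonsing_opl_iff[OF C(5,6), of "map tr bs"] ones_tr[OF bC] bC by auto
    have R: "range (opl (map tr bs)) = tr ` C" using range_opl[OF xF b(1)] b(2) by simp
    show ?thesis
      using memI[OF A1_opm(1)[OF bs(2)], unfolded A1_opm(2)[OF bs(2)], OF symop_opl[OF xF] ns R]
      unfolding bs(1) .
  qed
  have in2: "A2 n B \<in> {A \<in> SGL n. range (opm (A - 1\<^sub>m n)) = tr ` C}"
    if B: "B \<in> bases (n + 1) C" and ev: "even m" for B
  proof -
    have "finite B" "B \<subseteq> C" using B by (auto simp: bases_def is_basis_def)
    then obtain bs where bs: "set bs = B" "distinct bs" using finite_distinct_list by blast
    have bC: "set bs \<subseteq> C" using bs \<open>B \<subseteq> C\<close> by simp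
    have b: "lindep (map tr bs)" "lspan (map tr bs) = tr ` C"
      using bases_iff[OF sd bs(2) bC] B bs(1) by auto
    let ?xs = "map tr bs" and ?s = "comb (\<lambda>_. 1) (map tr bs)"
    have xF: "set ?xs \<subseteq> F" by auto
    have sV: "?s \<in> tr ` C" using comb_lspan[of "\<lambda>_. 1" ?xs] b(2) by simp
    have xsV: "set (?s # ?xs) \<subseteq> tr ` C" using sV bC by auto
    \<comment> \<open>The parity of the total equals the parity count of the basis, so adding its
      square always makes the count even; hence all bases occur in \<open>A2\<close>.\<close>
    have "dot ones ?s = (\<Sum>x\<leftarrow>?xs. dot ones x)"
      using dot_comb[of "\<lambda>_. 1" ?xs ones] by (simp add: dot_commute)
    then have "(\<Sum>x\<leftarrow>?s # ?xs. dot ones x) = 0" by simp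
    then have "nonsing (opl (?s # ?xs))" using nonsing_opl_iff[OF C(5,6) xsV] by blast
    then have ns: "nonsing (upd (opl ?xs) ?s)" by simp
    have sy: "symop (upd (opl ?xs) ?s)" using symop_upd[OF symop_opl[OF xF]] sV VF by blast
    have R: "range (upd (opl ?xs) ?s) = tr ` C"
      using range_opl_sum[OF xF b(1)] len[OF b] ev b(2) by simp
    show ?thesis
      using memI[OF A2_opm(1)[OF bs(2)], unfolded A2_opm(2)[OF bs(2)], OF sy ns R] unfolding bs(1) .
  qed
  have out: "A \<in> FC n C" if A: "A \<in> SGL n" and R: "range (opm (A - 1\<^sub>m n)) = tr ` C" for A
  proof -
    let ?D = "opm (A - 1\<^sub>m n)"
    have Ac: "A \<in> carrier_mat n n" using A by (simp add: SGL_def)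
    have D: "symop ?D" "nonsing ?D" using A SGL_iff[OF Ac] by auto
    have c: "card (range ?D) = 2 ^ m" using R cV by simp
    have lift: "\<exists>bs. distinct bs \<and> set bs \<subseteq> C \<and> map tr bs = xs \<and> set bs \<in> bases (n + 1) C"
      if xs: "lindep xs" "lspan xs = tr ` C" for xs
    proof -
      let ?bs = "map parity_lift xs"
      have xsV: "set xs \<subseteq> tr ` C" using lspan_set xs(2) by auto
      have m: "map tr ?bs = xs" using xsV VF by (auto simp: map_idI tr_parity_lift subset_iff)
      have "distinct (map tr ?bs)" unfolding m by (rule lindep_distinct[OF xs(1)])
      then have "distinct ?bs" using distinct_map by blast
      moreover have "set ?bs \<subseteq> C" using xsV C(4) by auto
      ultimately show ?thesis using bases_iff[OF sd, of ?bs] xs m by metis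
    qed
    show ?thesis
    proof (cases "dg ?D = 0")
      case False
      then obtain xs where xs: "?D = opl xs" "lindep xs" "lspan xs = tr ` C"
        using diagonal_basis[OF D(1) c] R by auto
      obtain bs where bs: "distinct bs" "set bs \<subseteq> C" "map tr bs = xs" "set bs \<in> bases (n + 1) C"
        using lift[OF xs(2,3)] by blast
      have "A = A1 n (set bs)"
        using opm_minus_one_inj[OF Ac A1_opm(1)[OF bs(1)]] A1_opm(2)[OF bs(1)] xs(1) bs(3) by simp
      moreover have "set bs \<in> bases2 n C"
      proof -
        have "set xs \<subseteq> tr ` C" using bs(2,3) by (metis image_mono set_map)
        then have "(\<Sum>x\<leftarrow>xs. dot ones x) = 0"
          using nonsing_opl_iff[OF C(5,6)] D(2) xs(1) by simp
        then have "(\<Sum>b\<leftarrow>bs. b $ n) = 0" using ones_tr[OF bs(2)] bs(3) by simp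
        then show ?thesis using sum_last_parity[OF bs(1)] bs(4) by (simp add: bases2_def)
      qed
      ultimately show ?thesis by (auto simp: FC_def)
    next
      case True
      then obtain xs where xs: "?D = upd (opl xs) (comb (\<lambda>_. 1) xs)" "lindep xs" "lspan xs = tr ` C"
        "even (length xs)"
        using alternating_basis[OF D(1) c m(2)] R by auto
      obtain bs where bs: "distinct bs" "set bs \<subseteq> C" "map tr bs = xs" "set bs \<in> bases (n + 1) C"
        using lift[OF xs(2,3)] by blast
      have "A = A2 n (set bs)"
        using opm_minus_one_inj[OF Ac A2_opm(1)[OF bs(1)]] A2_opm(2)[OF bs(1)] xs(1) bs(3) by simp
      moreover have "even m" using len[OF xs(2,3)] xs(4) by simp
      ultimately show ?thesis using bs(4) by (auto simp: FC_def m_def)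
    qed
  qed
  show ?thesis
  proof (intro equalityI subsetI)
    fix A assume A: "A \<in> FC n C"
    show "A \<in> {A \<in> SGL n. range (opm (A - 1\<^sub>m n)) = tr ` C}"
    proof (cases "even m")
      case True
      then consider B where "A = A1 n B" "B \<in> bases2 n C" | B where "A = A2 n B" "B \<in> bases (n + 1) C"
        using A unfolding FC_def m_def by auto
      then show ?thesis
      proof cases
        case 1
        show ?thesis unfolding 1(1) by (rule in1[OF 1(2)])
      next
        case 2
        show ?thesis unfolding 2(1) by (rule in2[OF 2(2) True])
      qed
    next
      case False
      then obtain B where B: "A = A1 n B" "B \<in> bases2 n C" using A unfolding FC_def m_def by auto
      show ?thesis unfolding B(1) by (rule in1[OF B(2)])
    qed
  qed (use out in blast)
qed

end

text \<open>By \<open>FC_eq\<close> a member of a class determines the truncated code, and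
  \<open>parity_lift\<close> recovers the code, which gives disjointness. Conversely, distance rank
  + 2 rules out paths of length rank and rank + 1, so \<open>conn_not_special\<close> leaves only a
  special column space.\<close>

theorem theorem8p3:
  fixes n :: nat
  assumes "odd n" and "n \<ge> 3"
  shows "(\<forall>C. self_dual (n + 1) C \<longrightarrow> FC n C \<subseteq> SD n)
       \<and> (\<forall>C C'. self_dual (n + 1) C \<and> self_dual (n + 1) C' \<and> C \<noteq> C'
                 \<longrightarrow> FC n C \<inter> FC n C' = {})
       \<and> SD n \<subseteq> (\<Union>{FC n C | C. self_dual (n + 1) C})"
proof (intro conjI allI impI)
  interpret binary_space n .
  define m where "m = (n + 1) div 2"
  have m: "n + 1 = m + m" "(n + 5) div 2 = Suc (Suc m)"
    using assms(1) by (auto simp: m_def elim!: oddE)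
  have inv: "\<exists>E. inv_pair (opm (A - 1\<^sub>m n)) E" and rank: "card (range (opm (A - 1\<^sub>m n))) = 2 ^ rk n (A - 1\<^sub>m n)"
    if "A \<in> SGL n" for A
  proof -
    have Ac: "A \<in> carrier_mat n n" using that by (simp add: SGL_def)
    then show "\<exists>E. inv_pair (opm (A - 1\<^sub>m n)) E" using SGL_iff[OF Ac] that nonsing_inv_pair by blast
    show "card (range (opm (A - 1\<^sub>m n))) = 2 ^ rk n (A - 1\<^sub>m n)"
      by (intro card_range_opm minus_carrier_mat) simp
  qed
  {
    fix C assume sd: "self_dual (n + 1) C"
    note C = self_dualD[OF sd]
    show "FC n C \<subseteq> SD n"
    proof
      fix A assume "A \<in> FC n C"
      then have A: "A \<in> SGL n" "range (opm (A - 1\<^sub>m n)) = tr ` C" using FC_eq[OF sd assms(1)] by auto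
      let ?D = "opm (A - 1\<^sub>m n)"
      obtain E where E: "inv_pair ?D E" using inv[OF A(1)] by blast
      have "(card (tr ` C))\<^sup>2 = (2 ^ m)\<^sup>2" using C(8) unfolding m(1) by (simp add: power2_eq_square power_add)
      then have c: "card (range ?D) = 2 ^ m" using A(2) by simp
      have sp: "special (range ?D)" using C(6) A(2) by simp
      \<comment> \<open>Otherwise the whole column space would have even weight, but it contains the
        truncation of a codeword ending in 1.\<close>
      have o: "?D ones \<noteq> 0"
      proof
        assume "?D ones = 0"
        then have "\<forall>v\<in>range ?D. dot ones v = 0"
          using symop_adj[OF inv_pairD(1)[OF E], of ones] by auto
        then show False using C(7) A(2) by force
      qed
      have "conn (Suc (Suc m)) ?D" by (rule conn_special[OF E c sp o assms(1)])
      moreover have "\<not> conn k ?D" if "k < Suc (Suc m)" for k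
        using conn_special_lower[OF _ c sp o, of k] that by auto
      ultimately have "gdist n A (1\<^sub>m n) = enat (Suc (Suc m))" using gdist_iff[OF A(1)] by blast
      moreover have "rk n (A - 1\<^sub>m n) = m" using rank[OF A(1)] c by simp
      ultimately show "A \<in> SD n" using A(1) m(2) by (simp add: SD_def m_def)
    qed
  }
  {
    fix C C' assume "self_dual (n + 1) C \<and> self_dual (n + 1) C' \<and> C \<noteq> C'"
    then have sd: "self_dual (n + 1) C" "self_dual (n + 1) C'" and ne: "C \<noteq> C'" by auto
    show "FC n C \<inter> FC n C' = {}"
    proof (rule ccontr)
      assume "FC n C \<inter> FC n C' \<noteq> {}"
      then have "tr ` C = tr ` C'" using FC_eq[OF sd(1) assms(1)] FC_eq[OF sd(2) assms(1)] by auto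
      then show False using self_dualD(4)[OF sd(1)] self_dualD(4)[OF sd(2)] ne by simp
    qed
  }
  show "SD n \<subseteq> \<Union> {FC n C |C. self_dual (n + 1) C}"
  proof
    fix A assume "A \<in> SD n"
    then have A: "A \<in> SGL n" and g: "gdist n A (1\<^sub>m n) = enat (Suc (Suc m))" and r: "rk n (A - 1\<^sub>m n) = m"
      using m(2) by (auto simp: SD_def m_def)
    let ?D = "opm (A - 1\<^sub>m n)"
    obtain E where E: "inv_pair ?D E" using inv[OF A] by blast
    have c: "card (range ?D) = 2 ^ m" using rank[OF A] r by simp
    have "\<forall>k<Suc (Suc m). \<not> conn k ?D" using gdist_iff[OF A, of "Suc (Suc m)"] g by blast
    then have "\<not> conn m ?D" "\<not> conn (Suc m) ?D" by simp_all
    then have sp: "special (range ?D)" using conn_not_special[OF E c] by blast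
    have V: "subspace (range ?D)" by (rule symop_range[OF inv_pairD(1)[OF E]])
    \<comment> \<open>Rank (n + 1) / 2 is exactly the dimension of a self-dual code of length n +
      1.\<close>
    have "card (range ?D) * card (range ?D) = 2 ^ (n + 1)" using c unfolding m(1) by (simp add: power_add)
    then have sd: "self_dual (n + 1) (parity_lift ` range ?D)"
      using self_dual_parity_lift[OF V sp] assms(1) by blast
    have "tr ` parity_lift ` range ?D = range ?D"
      using subspaceD(1)[OF V] by (force simp: image_image tr_parity_lift)
    then have "A \<in> FC n (parity_lift ` range ?D)" using FC_eq[OF sd assms(1)] A by simp
    then show "A \<in> \<Union> {FC n C |C. self_dual (n + 1) C}" using sd by blast
  qed
qed

end
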